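(* For all $x,y,x',y'\in M$, $$\langle\langle x,y\rangle\rangle=\langle\langle x',y'\rangle\rangle \iff x=x' \text{ and } y=y'.$$
   Context: Work in ZFA, i.e. ZF with a set $A$ of atoms. Fix a preorder $\preccurlyeq$ on $A$ with no minimal elements: for every $a\in A$ there is $b\in A$ with $b\preccurlyeq a$ and $a\not\preccurlyeq b$. For $a\in A$ let $pr(a)=\{b\in A:b\preccurlyeq a\}$. Define the magmatic hierarchy: $M_1$ is the set of nonempty subsets $x\subseteq A$ that are downward closed ($a\in x$ and $b\preccurlyeq a$ imply $b\in x$); for $\alpha\geq 1$, $M_{\alpha+1}$ is the set of nonempty $x\subseteq M_\alpha$ such that for every $y\in x$, every $z\in M_\alpha$ with $z\subseteq y$ belongs to $x$; $M_\lambda=\bigcup_{1\leq\beta<\lambda}M_\beta$ for limit $\lambda$; $M=\bigcup_{\alpha\geq1}M_\alpha$. For $x\in M$ let $pr(x)=\{y\in M:y\subseteq x\}$, and $pr^2=pr\circ pr$. Fix two atoms $a_0,a_1\in A$ incomparable under $\preccurlyeq$ ($a_0\not\preccurlyeq a_1$ and $a_1\not\preccurlyeq a_0$). For $x,y\in M$ the magmatic pair is $\langle\langle x,y\rangle\rangle:=pr(pr^2(x)\cup pr^2(a_0))\cup pr(pr^2(y)\cup pr^2(a_1))$. *)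

theory Defs
  imports Main
begin

text \<open>
  Set theory with atoms, ZFA, is rendered as the class of all its first-order models: the type is
  the universe of the model. Separation and Replacement range only over first-order formulas with
  parameters, so that no second-order comprehension is assumed of the model. Formulas use
  de Bruijn indices; the constants for the empty set and for the set of atoms may enter a formula
  as parameters and therefore need no syntax of their own.
\<close>

datatype fm = Member nat nat | Equal nat nat | Neg fm | And fm fm | Exists fm

primrec sat :: "('v \<Rightarrow> 'v \<Rightarrow> bool) \<Rightarrow> (nat \<Rightarrow> 'v) \<Rightarrow> fm \<Rightarrow> bool" where
  "sat E e (Member i j) \<longleftrightarrow> E (e i) (e j)"
| "sat E e (Equal i j) \<longleftrightarrow> e i = e j"
| "sat E e (Neg p) \<longleftrightarrow> \<not> sat E e p"
| "sat E e (And p q) \<longleftrightarrow> sat E e p \<and> sat E e q"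
| "sat E e (Exists p) \<longleftrightarrow> (\<exists>x. sat E (case_nat x e) p)"

class zfa =
  fixes mem :: "'a \<Rightarrow> 'a \<Rightarrow> bool"  (infix \<open>\<^bold>\<in>\<close> 50)
    and nul :: 'a
    and atoms :: 'a
  assumes empty_set: "\<not> x \<^bold>\<in> nul"
    and atoms: "z \<^bold>\<in> atoms \<longleftrightarrow> z \<noteq> nul \<and> (\<nexists>x. x \<^bold>\<in> z)"
    and extensionality:
      "\<not> x \<^bold>\<in> atoms \<Longrightarrow> \<not> y \<^bold>\<in> atoms \<Longrightarrow> (\<forall>z. z \<^bold>\<in> x \<longleftrightarrow> z \<^bold>\<in> y) \<Longrightarrow> x = y"
    and foundation: "\<exists>x. x \<^bold>\<in> s \<Longrightarrow> \<exists>x. x \<^bold>\<in> s \<and> \<not> (\<exists>z. z \<^bold>\<in> x \<and> z \<^bold>\<in> s)"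
    and pairing: "\<exists>p. \<forall>z. z \<^bold>\<in> p \<longleftrightarrow> z = x \<or> z = y"
    and union: "\<exists>v. \<forall>z. z \<^bold>\<in> v \<longleftrightarrow> (\<exists>y. z \<^bold>\<in> y \<and> y \<^bold>\<in> u)"
    and powerset:
      "\<exists>v. \<forall>y. y \<^bold>\<in> v \<longleftrightarrow> \<not> y \<^bold>\<in> atoms \<and> (\<forall>z. z \<^bold>\<in> y \<longrightarrow> z \<^bold>\<in> u)"
    and infinity:
      "\<exists>s. nul \<^bold>\<in> s \<and>
         (\<forall>x. x \<^bold>\<in> s \<longrightarrow> (\<exists>y. y \<^bold>\<in> s \<and> (\<forall>z. z \<^bold>\<in> y \<longleftrightarrow> z \<^bold>\<in> x \<or> z = x)))"
    and separation:
      "\<exists>v. \<forall>x. x \<^bold>\<in> v \<longleftrightarrow> x \<^bold>\<in> u \<and> sat (\<^bold>\<in>) (case_nat x e) p"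
    and replacement:
      "(\<And>x y z. x \<^bold>\<in> u \<Longrightarrow> sat (\<^bold>\<in>) (case_nat x (case_nat y e)) p \<Longrightarrow>
          sat (\<^bold>\<in>) (case_nat x (case_nat z e)) p \<Longrightarrow> y = z) \<Longrightarrow>
       \<exists>v. \<forall>y. y \<^bold>\<in> v \<longleftrightarrow> (\<exists>x. x \<^bold>\<in> u \<and> sat (\<^bold>\<in>) (case_nat x (case_nat y e)) p)"

definition is_set :: "'v::zfa \<Rightarrow> bool" where
  "is_set x \<longleftrightarrow> \<not> x \<^bold>\<in> atoms"

definition subset_of :: "'v::zfa \<Rightarrow> 'v \<Rightarrow> bool"  (infix \<open>\<^bold>\<subseteq>\<close> 50) where
  "x \<^bold>\<subseteq> y \<longleftrightarrow> is_set x \<and> is_set y \<and> (\<forall>z. z \<^bold>\<in> x \<longrightarrow> z \<^bold>\<in> y)"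

text \<open>The set of the model whose elements are those satisfying \<open>P\<close>, when there is one.\<close>

definition the_set :: "('v::zfa \<Rightarrow> bool) \<Rightarrow> 'v" where
  "the_set P = (THE v. is_set v \<and> (\<forall>z. z \<^bold>\<in> v \<longleftrightarrow> P z))"

definition upair :: "'v::zfa \<Rightarrow> 'v \<Rightarrow> 'v" where
  "upair x y = the_set (\<lambda>z. z = x \<or> z = y)"

definition kpair :: "'v::zfa \<Rightarrow> 'v \<Rightarrow> 'v" where
  "kpair x y = upair (upair x x) (upair x y)"

definition un :: "'v::zfa \<Rightarrow> 'v \<Rightarrow> 'v"  (infixl \<open>\<^bold>\<union>\<close> 65) where
  "x \<^bold>\<union> y = the_set (\<lambda>z. z \<^bold>\<in> x \<or> z \<^bold>\<in> y)"

definition osucc :: "'v::zfa \<Rightarrow> 'v" where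
  "osucc x = the_set (\<lambda>z. z \<^bold>\<in> x \<or> z = x)"

text \<open>Von Neumann ordinals of the model; the elements of an ordinal are required to be sets
  because an atom is vacuously transitive.\<close>

definition transitive_set :: "'v::zfa \<Rightarrow> bool" where
  "transitive_set x \<longleftrightarrow> is_set x \<and> (\<forall>y z. y \<^bold>\<in> x \<longrightarrow> z \<^bold>\<in> y \<longrightarrow> z \<^bold>\<in> x)"

definition ordinal :: "'v::zfa \<Rightarrow> bool" where
  "ordinal \<alpha> \<longleftrightarrow> transitive_set \<alpha> \<and> (\<forall>\<beta>. \<beta> \<^bold>\<in> \<alpha> \<longrightarrow> transitive_set \<beta>)"

definition limit_ordinal :: "'v::zfa \<Rightarrow> bool" where
  "limit_ordinal \<alpha> \<longleftrightarrow> ordinal \<alpha> \<and> \<alpha> \<noteq> nul \<and> (\<forall>\<beta>. \<beta> \<^bold>\<in> \<alpha> \<longrightarrow> osucc \<beta> \<^bold>\<in> \<alpha>)"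

definition atom_le :: "'v::zfa \<Rightarrow> 'v \<Rightarrow> 'v \<Rightarrow> bool" where
  "atom_le R b a \<longleftrightarrow> kpair b a \<^bold>\<in> R"

definition preorder_on_atoms :: "'v::zfa \<Rightarrow> bool" where
  "preorder_on_atoms R \<longleftrightarrow>
     is_set R \<and>
     (\<forall>p. p \<^bold>\<in> R \<longrightarrow> (\<exists>a b. a \<^bold>\<in> atoms \<and> b \<^bold>\<in> atoms \<and> p = kpair a b)) \<and>
     (\<forall>a. a \<^bold>\<in> atoms \<longrightarrow> atom_le R a a) \<and>
     (\<forall>a b c. atom_le R a b \<longrightarrow> atom_le R b c \<longrightarrow> atom_le R a c)"

definition no_minimal_atoms :: "'v::zfa \<Rightarrow> bool" where
  "no_minimal_atoms R \<longleftrightarrow>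
     (\<forall>a. a \<^bold>\<in> atoms \<longrightarrow> (\<exists>b. b \<^bold>\<in> atoms \<and> atom_le R b a \<and> \<not> atom_le R a b))"

definition magma_base :: "'v::zfa \<Rightarrow> 'v" where
  "magma_base R = the_set (\<lambda>x. x \<^bold>\<subseteq> atoms \<and> x \<noteq> nul \<and>
     (\<forall>a b. a \<^bold>\<in> x \<longrightarrow> b \<^bold>\<in> atoms \<longrightarrow> atom_le R b a \<longrightarrow> b \<^bold>\<in> x))"

definition magma_next :: "'v::zfa \<Rightarrow> 'v" where
  "magma_next m = the_set (\<lambda>x. x \<^bold>\<subseteq> m \<and> x \<noteq> nul \<and>
     (\<forall>y z. y \<^bold>\<in> x \<longrightarrow> z \<^bold>\<in> m \<longrightarrow> z \<^bold>\<subseteq> y \<longrightarrow> z \<^bold>\<in> x))"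

definition app :: "'v::zfa \<Rightarrow> 'v \<Rightarrow> 'v" where
  "app f x = (THE y. kpair x y \<^bold>\<in> f)"

text \<open>\<open>magma_seq R \<alpha> f\<close>: inside the model, \<open>f\<close> is the function with domain the ordinals
  \<open>1 \<le> \<beta> \<le> \<alpha>\<close> that obeys the recursion of the magmatic hierarchy.\<close>

definition magma_seq :: "'v::zfa \<Rightarrow> 'v \<Rightarrow> 'v \<Rightarrow> bool" where
  "magma_seq R \<alpha> f \<longleftrightarrow>
     is_set f \<and>
     (\<forall>p. p \<^bold>\<in> f \<longrightarrow> (\<exists>\<beta> m. \<beta> \<^bold>\<in> osucc \<alpha> \<and> \<beta> \<noteq> nul \<and> p = kpair \<beta> m)) \<and>
     (\<forall>\<beta>. \<beta> \<^bold>\<in> osucc \<alpha> \<and> \<beta> \<noteq> nul \<longrightarrow> (\<exists>!m. kpair \<beta> m \<^bold>\<in> f)) \<and>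
     (osucc nul \<^bold>\<in> osucc \<alpha> \<longrightarrow> app f (osucc nul) = magma_base R) \<and>
     (\<forall>\<beta>. \<beta> \<noteq> nul \<and> osucc \<beta> \<^bold>\<in> osucc \<alpha> \<longrightarrow> app f (osucc \<beta>) = magma_next (app f \<beta>)) \<and>
     (\<forall>\<gamma>. limit_ordinal \<gamma> \<and> \<gamma> \<^bold>\<in> osucc \<alpha> \<longrightarrow>
        app f \<gamma> = the_set (\<lambda>x. \<exists>\<beta>. \<beta> \<^bold>\<in> \<gamma> \<and> \<beta> \<noteq> nul \<and> x \<^bold>\<in> app f \<beta>))"

definition magma_level :: "'v::zfa \<Rightarrow> 'v \<Rightarrow> 'v" where
  "magma_level R \<alpha> = app (THE f. magma_seq R \<alpha> f) \<alpha>"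

text \<open>The hierarchy is a proper class of the model, hence a HOL set.\<close>

definition magmas :: "'v::zfa \<Rightarrow> 'v set" where
  "magmas R = {x. \<exists>\<alpha>. ordinal \<alpha> \<and> \<alpha> \<noteq> nul \<and> x \<^bold>\<in> magma_level R \<alpha>}"

definition pr :: "'v::zfa \<Rightarrow> 'v \<Rightarrow> 'v" where
  "pr R x =
     (if x \<^bold>\<in> atoms then the_set (\<lambda>b. b \<^bold>\<in> atoms \<and> atom_le R b x)
      else the_set (\<lambda>y. y \<in> magmas R \<and> y \<^bold>\<subseteq> x))"

definition magma_pair :: "'v::zfa \<Rightarrow> 'v \<Rightarrow> 'v \<Rightarrow> 'v \<Rightarrow> 'v \<Rightarrow> 'v" where
  "magma_pair R a0 a1 x y =
     pr R (pr R (pr R x) \<^bold>\<union> pr R (pr R a0)) \<^bold>\<union> pr R (pr R (pr R y) \<^bold>\<union> pr R (pr R a1))"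

end

theory Submission
  imports Defs
begin

text \<open>
  Put
  \<open>U(x,a) = pr(pr(x)) \<union> pr(pr(a))\<close>. This union mixes two levels, but it lies in the level after any
  limit level above both, so \<open>U(x,a)\<close> is itself a magma and hence an element of \<open>pr(U(x,a))\<close>.
  Equality of two pairs therefore makes \<open>U(x,a0)\<close> a subset of \<open>U(x',a0)\<close> or of \<open>U(y',a1)\<close>. The second
  is impossible, since \<open>pr(a0)\<close> contains the atom \<open>a0\<close>, which is neither a magma nor below \<open>a1\<close>.
  In the first, \<open>pr(x)\<close> contains no atoms and so lies in \<open>pr(pr(x'))\<close>, which gives \<open>x \<subseteq> x'\<close>.

  Separation and Replacement hold only for first-order formulas, so transfinite induction and the
  recursion defining the hierarchy are available only for definable classes; closure properties of
  definability with parameters replace explicit formulas.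
\<close>

section \<open>Definability with parameters\<close>

text \<open>Each component of the pair applies pr twice inside because pr(a) consists of atoms while
  pr(x) consists of magmas, so the union of these two sets would mix atoms with sets and lie in no
  level. After the second pr both parts consist of magmas, but a successor level need not include
  the level before it, so a limit level is used to hold both; that one exists above every ordinal
  takes Infinity and Replacement. The other ingredient is that a magma included in a magma of level
  \<alpha> is itself in level \<alpha>. It makes pr(x) a set of magmas of level \<alpha>, hence a
  member of the next level.

  The formal obstacle is that the hierarchy is specified with description operators, which formulas
  cannot express. Levels are therefore first characterised by a relation about ordered pairs in
  approximating functions; only then can induction and Replacement be applied to statements about
  magmas.\<close>

primrec ren :: "(nat \<Rightarrow> nat) \<Rightarrow> fm \<Rightarrow> fm" where
  "ren f (Member i j) = Member (f i) (f j)"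
| "ren f (Equal i j) = Equal (f i) (f j)"
| "ren f (Neg p) = Neg (ren f p)"
| "ren f (And p q) = And (ren f p) (ren f q)"
| "ren f (Exists p) = Exists (ren (case_nat 0 (\<lambda>i. Suc (f i))) p)"

lemma sat_ren: "sat E e (ren f p) \<longleftrightarrow> sat E (\<lambda>i. e (f i)) p"
proof (induction p arbitrary: e f)
  case (Exists p)
  have "(\<lambda>i. case_nat x e (case_nat 0 (\<lambda>i. Suc (f i)) i)) = case_nat x (\<lambda>i. e (f i))" for x
    by (auto simp: fun_eq_iff split: nat.split)
  then show ?case by (simp add: Exists.IH)
qed auto

text \<open>Variables occupy the even slots and parameters the odd ones. Both supplies stay
  infinite, so no bound on the free variables of a formula has to be tracked.\<close>

definition mix :: "(nat \<Rightarrow> 'v) \<Rightarrow> (nat \<Rightarrow> 'v) \<Rightarrow> nat \<Rightarrow> 'v" where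
  "mix e c i = (if even i then e (i div 2) else c (i div 2))"

lemma mix_eqI:
  assumes "\<And>i. e i = h (2 * i)" "\<And>i. c i = h (Suc (2 * i))"
  shows "mix e c = h"
proof
  fix i show "mix e c i = h i"
    by (cases "even i") (auto simp: mix_def assms elim!: evenE oddE)
qed

definition definable :: "((nat \<Rightarrow> 'v::zfa) \<Rightarrow> bool) \<Rightarrow> bool" where
  "definable Q \<longleftrightarrow> (\<exists>p c. \<forall>e. Q e \<longleftrightarrow> sat (\<^bold>\<in>) (mix e c) p)"

lemma definableI:
  assumes "\<And>e. Q e \<longleftrightarrow> sat (\<^bold>\<in>) (\<lambda>i. mix e c (f i)) p"
  shows "definable Q"
  unfolding definable_def using assms by (metis sat_ren)

lemma definable_rename:
  assumes "definable Q"
  shows "definable (\<lambda>e. Q (\<lambda>i. e (f i)))"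
proof -
  obtain p c where pc: "\<And>e. Q e \<longleftrightarrow> sat (\<^bold>\<in>) (mix e c) p" using assms unfolding definable_def by blast
  \<comment> \<open>Slot \<open>2 * k\<close> holds variable \<open>k\<close> and moves to the slot
    of variable \<open>f k\<close>; parameter slots stay fixed.\<close>
  let ?g = "\<lambda>i. if even i then 2 * f (i div 2) else i"
  have "mix (\<lambda>i. e (f i)) c = (\<lambda>i. mix e c (?g i))" for e :: "nat \<Rightarrow> 'a"
    by (auto simp: mix_def fun_eq_iff)
  then show ?thesis by (intro definableI[where c = c and f = ?g and p = p]) (simp add: pc)
qed

lemma definable_mem_var: "definable (\<lambda>e. e i \<^bold>\<in> e j)"
  by (rule definableI[where f = "\<lambda>i. 2 * i" and p = "Member i j"]) (simp add: mix_def)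

lemma definable_eq_var: "definable (\<lambda>e. e i = e j)"
  by (rule definableI[where f = "\<lambda>i. 2 * i" and p = "Equal i j"]) (simp add: mix_def)

lemma definable_eq_const: "definable (\<lambda>e. e i = c)"
  by (rule definableI[where f = id and p = "Equal (2 * i) 1" and c = "\<lambda>_. c"]) (simp add: mix_def)

lemma definable_not:
  assumes "definable P"
  shows "definable (\<lambda>e. \<not> P e)"
  using assms unfolding definable_def by (metis sat.simps(3))

lemma definable_conj:
  assumes "definable P" "definable Q"
  shows "definable (\<lambda>e. P e \<and> Q e)"
proof -
  obtain p c where p: "\<And>e. P e \<longleftrightarrow> sat (\<^bold>\<in>) (mix e c) p" using assms(1) unfolding definable_def by blast
  obtain q d where q: "\<And>e. Q e \<longleftrightarrow> sat (\<^bold>\<in>) (mix e d) q" using assms(2) unfolding definable_def by blast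
  \<comment> \<open>The two parameter lists are themselves interleaved: \<open>c k\<close> moves
    from slot \<open>2 * k + 1\<close> to \<open>4 * k + 1\<close>, and \<open>d k\<close> from
    there to \<open>4 * k + 3\<close>.\<close>
  let ?f = "\<lambda>j. if even j then j else 2 * j - 1" and ?g = "\<lambda>j. if even j then j else 2 * j + 1"
  have *: "mix e c = (\<lambda>i. mix e (mix c d) (?f i))" "mix e d = (\<lambda>i. mix e (mix c d) (?g i))"
    for e :: "nat \<Rightarrow> 'a"
    by (auto simp: mix_def intro!: mix_eqI)
  have "P e \<longleftrightarrow> sat (\<^bold>\<in>) (mix e (mix c d)) (ren ?f p)" "Q e \<longleftrightarrow> sat (\<^bold>\<in>) (mix e (mix c d)) (ren ?g q)" for e
    unfolding sat_ren *[symmetric] by (rule p q)+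
  then show ?thesis
    by (intro definableI[where f = id and c = "mix c d" and p = "And (ren ?f p) (ren ?g q)"]) simp
qed

lemma definable_ex:
  assumes "definable (\<lambda>e. P (e 0) (\<lambda>i. e (Suc i)))"
  shows "definable (\<lambda>e. \<exists>x. P x e)"
proof -
  obtain p c where p: "\<And>e. P (e 0) (\<lambda>i. e (Suc i)) \<longleftrightarrow> sat (\<^bold>\<in>) (mix e c) p"
    using assms unfolding definable_def by blast
  \<comment> \<open>The quantifier pushes \<open>x\<close> in front of the interleaved sequence,
    whereas \<open>mix\<close> expects it in front of the variables only. Hence later variables move
    down one slot and parameters up one slot.\<close>
  let ?g = "\<lambda>j. if j = 0 then 0 else if even j then j - 1 else j + 1"
  have *: "mix (case_nat x e) c = (\<lambda>i. case_nat x (mix e c) (?g i))" for e :: "nat \<Rightarrow> 'a" and x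
    by (auto simp: mix_def split: nat.split intro!: mix_eqI)
  have "P x e \<longleftrightarrow> sat (\<^bold>\<in>) (case_nat x (mix e c)) (ren ?g p)" for x e
    using p[of "case_nat x e"] by (simp add: sat_ren *)
  then show ?thesis
    by (intro definableI[where f = id and c = c and p = "Exists (ren ?g p)"]) simp
qed

lemma definable_imp:
  assumes "definable P" "definable Q"
  shows "definable (\<lambda>e. P e \<longrightarrow> Q e)"
  using definable_not[OF definable_conj[OF assms(1) definable_not[OF assms(2)]]] by simp

lemma definable_disj:
  assumes "definable P" "definable Q"
  shows "definable (\<lambda>e. P e \<or> Q e)"
  using definable_imp[OF definable_not[OF assms(1)] assms(2)] by (simp add: disj_imp)

lemma definable_iff:
  assumes "definable P" "definable Q"
  shows "definable (\<lambda>e. P e \<longleftrightarrow> Q e)"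
  using definable_conj[OF definable_imp[OF assms] definable_imp[OF assms(2,1)]]
  by (simp add: iff_conv_conj_imp)

lemma definable_all:
  assumes "definable (\<lambda>e. P (e 0) (\<lambda>i. e (Suc i)))"
  shows "definable (\<lambda>e. \<forall>x. P x e)"
  using definable_not[OF definable_ex[of "\<lambda>x e. \<not> P x e", OF definable_not[OF assms]]] by simp

section \<open>Definable functions of the environment\<close>

text \<open>Formulas have no function symbols, so a function is represented by its graph, with the
  value in variable 0.\<close>

definition dterm :: "((nat \<Rightarrow> 'v::zfa) \<Rightarrow> 'v) \<Rightarrow> bool" where
  "dterm F \<longleftrightarrow> definable (\<lambda>e. e 0 = F (\<lambda>i. e (Suc i)))"

lemma dterm_var: "dterm (\<lambda>e. e i)"
  unfolding dterm_def by (rule definable_eq_var)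

lemma dterm_const: "dterm (\<lambda>e. c)"
  unfolding dterm_def by (rule definable_eq_const)

lemma dterm_rename:
  assumes "dterm F"
  shows "dterm (\<lambda>e. F (\<lambda>i. e (f i)))"
  using definable_rename[OF assms[unfolded dterm_def], of "case_nat 0 (\<lambda>i. Suc (f i))"]
  unfolding dterm_def by simp

text \<open>A term is eliminated by naming its value: \<open>P (F e) e\<close> says that some
  \<open>x\<close> equals \<open>F e\<close> and satisfies \<open>P x e\<close>.\<close>

lemma definable_subst:
  assumes "dterm F" "definable (\<lambda>e. P (e 0) (\<lambda>i. e (Suc i)))"
  shows "definable (\<lambda>e. P (F e) e)"
  using definable_ex[of "\<lambda>x e. x = F e \<and> P x e", OF definable_conj[OF assms(1)[unfolded dterm_def] assms(2)]]
  by simp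

lemma definable_comp1:
  assumes "definable (\<lambda>e. P (e 0))" "dterm F"
  shows "definable (\<lambda>e. P (F e))"
  using definable_subst[OF assms(2), of "\<lambda>x e. P x"] assms(1) by simp

lemma definable_comp2:
  assumes "definable (\<lambda>e. P (e 0) (e 1))" "dterm F" "dterm G"
  shows "definable (\<lambda>e. P (F e) (G e))"
proof (rule definable_subst[OF assms(2)])
  show "definable (\<lambda>e. P (e 0) (G (\<lambda>i. e (Suc i))))"
  proof (rule definable_subst[OF dterm_rename[OF assms(3)]])
    show "definable (\<lambda>e. P (e (Suc 0)) (e 0))"
      using definable_rename[OF assms(1), of "\<lambda>i. if i = 0 then 1 else 0"] by simp
  qed
qed

lemma dterm_comp1:
  assumes "dterm (\<lambda>e. H (e 0))" "dterm F"
  shows "dterm (\<lambda>e. H (F e))"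
proof -
  have "definable (\<lambda>e. e 0 = H (e 1))" using assms(1) unfolding dterm_def by simp
  then show ?thesis unfolding dterm_def
    by (rule definable_comp2[OF _ dterm_var dterm_rename[OF assms(2)]])
qed

lemma definable_mem:
  assumes "dterm F" "dterm G"
  shows "definable (\<lambda>e. F e \<^bold>\<in> G e)"
  using definable_comp2[where P = "(\<^bold>\<in>)", OF definable_mem_var assms] .

lemma definable_eq:
  assumes "dterm F" "dterm G"
  shows "definable (\<lambda>e. F e = G e)"
  using definable_comp2[where P = "(=)", OF definable_eq_var assms] .

named_theorems dintros

lemmas [dintros] = dterm_var dterm_const definable_mem definable_eq definable_not definable_conj
  definable_disj definable_imp definable_iff definable_ex definable_all

lemma definable_ex1 [dintros]:
  assumes "definable (\<lambda>e. P (e 0) (\<lambda>i. e (Suc i)))"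
  shows "definable (\<lambda>e. \<exists>!x. P x e)"
proof -
  \<comment> \<open>The uniqueness clause lies under two binders, so the environment of
    \<open>P\<close> has to skip both variables.\<close>
  have "definable (\<lambda>e. P (e 0) (\<lambda>i. e (Suc (Suc i))))"
    using definable_rename[OF assms, of "case_nat 0 (\<lambda>i. Suc (Suc i))"] by simp
  then show ?thesis unfolding Ex1_def by (intro dintros assms)
qed

lemma definable_is_set [dintros]: "dterm F \<Longrightarrow> definable (\<lambda>e. is_set (F e))"
  unfolding is_set_def by (intro dintros)

text \<open>The composition rule first replaces \<open>F\<close> and \<open>G\<close> by plain
  variables. Unfolding directly would leave them under the quantifier of the definition, in a
  shifted environment that the introduction rules do not match.\<close>

lemma definable_subset [dintros]: "dterm F \<Longrightarrow> dterm G \<Longrightarrow> definable (\<lambda>e. F e \<^bold>\<subseteq> G e)"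
  by (rule definable_comp2; (assumption)?) (unfold subset_of_def, intro dintros)

section \<open>Basic set formation\<close>

lemma is_set_nul [simp]: "is_set nul"
  unfolding is_set_def using atoms by blast

lemma is_setI: "z \<^bold>\<in> x \<Longrightarrow> is_set x"
  unfolding is_set_def using atoms by blast

lemma set_ext:
  assumes "is_set x" "is_set y" "\<And>z. z \<^bold>\<in> x \<longleftrightarrow> z \<^bold>\<in> y"
  shows "x = y"
  using extensionality assms unfolding is_set_def by blast

lemma nonempty_set:
  assumes "is_set x" "x \<noteq> nul"
  obtains z where "z \<^bold>\<in> x"
  using assms set_ext[OF assms(1) is_set_nul] empty_set by blast

text \<open>Replaces the description operator by a case distinction built from logical connectives,
  which the closure rules for definability can handle. Extensionality among sets makes the first
  alternative unique.\<close>

lemma the_set_eq_iff: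
  "v = the_set P \<longleftrightarrow> is_set v \<and> (\<forall>z. z \<^bold>\<in> v \<longleftrightarrow> P z)
     \<or> \<not> (\<exists>w. is_set w \<and> (\<forall>z. z \<^bold>\<in> w \<longleftrightarrow> P z)) \<and> v = (THE w. False)"
proof (cases "\<exists>w. is_set w \<and> (\<forall>z. z \<^bold>\<in> w \<longleftrightarrow> P z)")
  case True
  then obtain w where w: "is_set w" "\<And>z. z \<^bold>\<in> w \<longleftrightarrow> P z" by blast
  have uniq: "v = w" if "is_set v" "\<forall>z. z \<^bold>\<in> v \<longleftrightarrow> P z" for v
    using that w by (intro set_ext) simp_all
  have "the_set P = w"
    unfolding the_set_def by (rule the_equality) (simp_all add: w uniq)
  moreover have "is_set v \<and> (\<forall>z. z \<^bold>\<in> v \<longleftrightarrow> P z) \<longleftrightarrow> v = w" using w uniq[of v] by blast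
  ultimately show ?thesis using True by (simp only: simp_thms)
next
  case False
  \<comment> \<open>The described predicate is false everywhere, so the description collapses to one
    value that is independent of \<open>P\<close>.\<close>
  then have no: "(is_set w \<and> (\<forall>z. z \<^bold>\<in> w \<longleftrightarrow> P z)) = False" for w by blast
  have "the_set P = (THE w. False)" unfolding the_set_def no ..
  then show ?thesis unfolding no by (simp only: simp_thms)
qed

lemma
  assumes "\<exists>v. \<forall>z. z \<^bold>\<in> v \<longleftrightarrow> P z"
  shows is_set_the_set: "is_set (the_set P)"
    and mem_the_set: "z \<^bold>\<in> the_set P \<longleftrightarrow> P z"
proof -
  obtain v where v: "\<forall>z. z \<^bold>\<in> v \<longleftrightarrow> P z" using assms by blast
  have "\<exists>w. is_set w \<and> (\<forall>z. z \<^bold>\<in> w \<longleftrightarrow> P z)"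
  \<comment> \<open>The existence axioms do not say that \<open>v\<close> is a set: if nothing
    satisfies \<open>P\<close>, an atom has the required elements as well, and \<open>nul\<close>
    then takes its place.\<close>
  proof (cases "is_set v")
    case False
    then have "\<not> z \<^bold>\<in> v" for z using is_setI by blast
    then show ?thesis using v empty_set is_set_nul by blast
  qed (use v in blast)
  then show "is_set (the_set P)" "z \<^bold>\<in> the_set P \<longleftrightarrow> P z"
    using the_set_eq_iff[of "the_set P" P] by blast+
qed

text \<open>No existence assumption is needed: the junk value of \<open>the_set\<close> is a single parameter.\<close>

lemma dterm_the_set [dintros]:
  assumes "definable (\<lambda>e. P (e 0) (\<lambda>i. e (Suc i)))"
  shows "dterm (\<lambda>e. the_set (\<lambda>z. P z e))"
proof -
  have "definable (\<lambda>e. P (e 0) (\<lambda>i. e (Suc (Suc i))))"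
    "definable (\<lambda>e. P (e 0) (\<lambda>i. e (Suc (Suc (Suc i)))))"
    using definable_rename[OF assms, of "case_nat 0 (\<lambda>i. Suc (Suc i))"]
      definable_rename[OF assms, of "case_nat 0 (\<lambda>i. Suc (Suc (Suc i)))"] by simp_all
  then show ?thesis unfolding dterm_def the_set_eq_iff by (intro dintros)
qed

section \<open>Separation and Replacement for definable predicates\<close>

lemma separation_definable:
  assumes "definable (\<lambda>e. P (e 0))"
  shows "\<exists>v. \<forall>x. x \<^bold>\<in> v \<longleftrightarrow> x \<^bold>\<in> u \<and> P x"
proof -
  obtain p c where p: "\<And>e. P (e 0) \<longleftrightarrow> sat (\<^bold>\<in>) (mix e c) p" using assms unfolding definable_def by blast
  \<comment> \<open>Only variable 0 matters, so every even slot is identified with it. Parameter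
    \<open>k\<close> goes from slot \<open>2 * k + 1\<close> to itself; once \<open>x\<close> is
    removed its index is \<open>2 * k\<close>, which explains the halving in
    \<open>c (i div 2)\<close>.\<close>
  let ?g = "\<lambda>j. if even j then 0 else Suc (j - 1)"
  have "mix (\<lambda>_. x) c = (\<lambda>i. case_nat x (\<lambda>i. c (i div 2)) (?g i))" for x
    by (auto intro!: mix_eqI)
  then have "P x \<longleftrightarrow> sat (\<^bold>\<in>) (case_nat x (\<lambda>i. c (i div 2))) (ren ?g p)" for x
    using p[of "\<lambda>_. x"] by (simp add: sat_ren)
  then show ?thesis using separation[of u "\<lambda>i. c (i div 2)" "ren ?g p"] by simp
qed

lemma replacement_definable:
  assumes "definable (\<lambda>e. P (e 0) (e 1))"
    and "\<And>x y z. x \<^bold>\<in> u \<Longrightarrow> P x y \<Longrightarrow> P x z \<Longrightarrow> y = z"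
  shows "\<exists>v. \<forall>y. y \<^bold>\<in> v \<longleftrightarrow> (\<exists>x. x \<^bold>\<in> u \<and> P x y)"
proof -
  obtain p c where p: "\<And>e. P (e 0) (e 1) \<longleftrightarrow> sat (\<^bold>\<in>) (mix e c) p" using assms(1) unfolding definable_def by blast
  \<comment> \<open>All variables beyond the first are identified with \<open>y\<close>. Two leading
    entries now precede the parameters, so odd slots move up by two.\<close>
  let ?g = "\<lambda>j. if j = 0 then 0 else if even j then 1 else Suc (Suc j)"
  have "mix (case_nat x (\<lambda>_. y)) c = (\<lambda>i. case_nat x (case_nat y (\<lambda>i. c (i div 2))) (?g i))" for x y
    by (auto split: nat.split intro!: mix_eqI)
  then have *: "P x y \<longleftrightarrow> sat (\<^bold>\<in>) (case_nat x (case_nat y (\<lambda>i. c (i div 2)))) (ren ?g p)" for x y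
    using p[of "case_nat x (\<lambda>_. y)"] by (simp add: sat_ren)
  show ?thesis
    using replacement[of u "\<lambda>i. c (i div 2)" "ren ?g p"] assms(2) unfolding * by blast
qed

lemma mem_upair [simp]: "z \<^bold>\<in> upair x y \<longleftrightarrow> z = x \<or> z = y"
  unfolding upair_def by (rule mem_the_set[OF pairing])

lemma is_set_upair [simp]: "is_set (upair x y)"
  unfolding upair_def by (rule is_set_the_set[OF pairing])

lemma upair_eq_iff: "upair x y = upair u v \<longleftrightarrow> x = u \<and> y = v \<or> x = v \<and> y = u"
proof
  assume "upair x y = upair u v"
  then have "z = x \<or> z = y \<longleftrightarrow> z = u \<or> z = v" for z using mem_upair by metis
  then show "x = u \<and> y = v \<or> x = v \<and> y = u" by metis
qed (auto intro: set_ext)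

lemma kpair_eq_iff [simp]: "kpair x y = kpair u v \<longleftrightarrow> x = u \<and> y = v"
  unfolding kpair_def by (auto simp: upair_eq_iff)

lemma ex_Union: "\<exists>v. \<forall>z. z \<^bold>\<in> v \<longleftrightarrow> (\<exists>y. y \<^bold>\<in> u \<and> z \<^bold>\<in> y)"
  using union[of u] by (simp add: conj_commute)

lemma ex_un: "\<exists>v. \<forall>z. z \<^bold>\<in> v \<longleftrightarrow> z \<^bold>\<in> x \<or> z \<^bold>\<in> y"
  using ex_Union[of "upair x y"] by (simp add: ex_disj_distrib conj_disj_distribR)

lemma mem_un [simp]: "z \<^bold>\<in> x \<^bold>\<union> y \<longleftrightarrow> z \<^bold>\<in> x \<or> z \<^bold>\<in> y"
  unfolding un_def by (rule mem_the_set[OF ex_un])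

lemma is_set_un [simp]: "is_set (x \<^bold>\<union> y)"
  unfolding un_def by (rule is_set_the_set[OF ex_un])

lemma ex_osucc: "\<exists>v. \<forall>z. z \<^bold>\<in> v \<longleftrightarrow> z \<^bold>\<in> x \<or> z = x"
  using ex_un[of x "upair x x"] by simp

lemma mem_osucc [simp]: "z \<^bold>\<in> osucc x \<longleftrightarrow> z \<^bold>\<in> x \<or> z = x"
  unfolding osucc_def by (rule mem_the_set[OF ex_osucc])

lemma is_set_osucc [simp]: "is_set (osucc x)"
  unfolding osucc_def by (rule is_set_the_set[OF ex_osucc])

lemma osucc_neq_nul [simp]: "osucc x \<noteq> nul" "nul \<noteq> osucc x"
  using mem_osucc[of x x] empty_set[of x] by metis+

lemma not_mem_nul [simp]: "\<not> x \<^bold>\<in> nul"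
  by (rule empty_set)

lemma dterm_upair [dintros]:
  assumes "dterm F" "dterm G"
  shows "dterm (\<lambda>e. upair (F e) (G e))"
proof -
  have "dterm (\<lambda>e. F (\<lambda>i. e (Suc i)))" "dterm (\<lambda>e. G (\<lambda>i. e (Suc i)))"
    by (rule assms[THEN dterm_rename])+
  then show ?thesis unfolding upair_def by (intro dintros)
qed

lemma dterm_kpair [dintros]: "dterm F \<Longrightarrow> dterm G \<Longrightarrow> dterm (\<lambda>e. kpair (F e) (G e))"
  unfolding kpair_def by (intro dintros)

lemma dterm_osucc [dintros]: "dterm F \<Longrightarrow> dterm (\<lambda>e. osucc (F e))"
  by (rule dterm_comp1; (assumption)?) (unfold osucc_def, intro dintros)

lemma dterm_magma_next [dintros]: "dterm F \<Longrightarrow> dterm (\<lambda>e. magma_next (F e))"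
  by (rule dterm_comp1; (assumption)?) (unfold magma_next_def, intro dintros)

lemma definable_transitive_set [dintros]: "dterm F \<Longrightarrow> definable (\<lambda>e. transitive_set (F e))"
  by (rule definable_comp1; (assumption)?) (unfold transitive_set_def, intro dintros)

lemma definable_ordinal [dintros]: "dterm F \<Longrightarrow> definable (\<lambda>e. ordinal (F e))"
  by (rule definable_comp1; (assumption)?) (unfold ordinal_def, intro dintros)

lemma definable_limit_ordinal [dintros]: "dterm F \<Longrightarrow> definable (\<lambda>e. limit_ordinal (F e))"
  by (rule definable_comp1; (assumption)?) (unfold limit_ordinal_def, intro dintros)

section \<open>Ordinals\<close>

lemma mem_irrefl [simp]: "\<not> x \<^bold>\<in> x"
  using foundation[of "upair x x"] by auto

lemma mem_asym: "x \<^bold>\<in> y \<Longrightarrow> \<not> y \<^bold>\<in> x"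
  using foundation[of "upair x y"] by auto

lemma osucc_inject [simp]: "osucc x = osucc y \<longleftrightarrow> x = y"
proof
  assume "osucc x = osucc y"
  then have "x \<^bold>\<in> osucc y" "y \<^bold>\<in> osucc x" using mem_osucc by metis+
  then show "x = y" using mem_asym[of x y] by simp blast
qed simp

lemma ordinal_is_set: "ordinal \<alpha> \<Longrightarrow> is_set \<alpha>"
  unfolding ordinal_def transitive_set_def by blast

lemma ordinal_mem: "ordinal \<alpha> \<Longrightarrow> \<beta> \<^bold>\<in> \<alpha> \<Longrightarrow> ordinal \<beta>"
  unfolding ordinal_def transitive_set_def by blast

lemma ordinal_trans: "ordinal \<alpha> \<Longrightarrow> \<beta> \<^bold>\<in> \<alpha> \<Longrightarrow> \<gamma> \<^bold>\<in> \<beta> \<Longrightarrow> \<gamma> \<^bold>\<in> \<alpha>"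
  unfolding ordinal_def transitive_set_def by blast

lemma ordinal_nul [simp]: "ordinal nul"
  unfolding ordinal_def transitive_set_def by simp

lemma ordinal_osucc [simp]:
  assumes "ordinal \<alpha>"
  shows "ordinal (osucc \<alpha>)"
proof -
  have "transitive_set (osucc \<alpha>)"
    using assms unfolding ordinal_def transitive_set_def mem_osucc by (metis is_set_osucc)
  then show ?thesis using assms unfolding ordinal_def mem_osucc by metis
qed

lemma ordinal_osuccD: "ordinal (osucc \<alpha>) \<Longrightarrow> ordinal \<alpha>"
  by (rule ordinal_mem[of "osucc \<alpha>"]) simp_all

text \<open>Definability is what lets Separation collect the counterexamples in
  \<open>osucc \<alpha>\<close> into a set. Foundation yields a minimal one, and transitivity keeps
  its elements within \<open>osucc \<alpha>\<close>.\<close>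

lemma ordinal_induct:
  assumes "ordinal \<alpha>" and P: "definable (\<lambda>e. P (e 0))"
    and step: "\<And>\<alpha>. ordinal \<alpha> \<Longrightarrow> (\<And>\<beta>. \<beta> \<^bold>\<in> \<alpha> \<Longrightarrow> P \<beta>) \<Longrightarrow> P \<alpha>"
  shows "P \<alpha>"
proof (rule ccontr)
  assume "\<not> P \<alpha>"
  obtain v where v: "\<And>x. x \<^bold>\<in> v \<longleftrightarrow> x \<^bold>\<in> osucc \<alpha> \<and> \<not> P x"
    using separation_definable[OF definable_not[OF P], of "osucc \<alpha>"] by blast
  then have "\<alpha> \<^bold>\<in> v" using \<open>\<not> P \<alpha>\<close> by simp
  then obtain \<beta> where \<beta>: "\<beta> \<^bold>\<in> v" "\<not> (\<exists>z. z \<^bold>\<in> \<beta> \<and> z \<^bold>\<in> v)" using foundation[of v] by blast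
  have o: "ordinal (osucc \<alpha>)" using assms(1) by simp
  have "\<beta> \<^bold>\<in> osucc \<alpha>" "\<not> P \<beta>" using \<beta>(1) v by auto
  moreover have "P \<gamma>" if "\<gamma> \<^bold>\<in> \<beta>" for \<gamma>
    using \<beta>(2) v ordinal_trans[OF o \<open>\<beta> \<^bold>\<in> osucc \<alpha>\<close> that] that by blast
  ultimately show False using step ordinal_mem[OF o] by blast
qed

text \<open>A double induction: if \<alpha> and \<beta> were incomparable, the two induction
  hypotheses would give them the same elements, hence make them equal.\<close>

lemma ordinal_linear:
  assumes "ordinal \<alpha>" "ordinal \<beta>"
  shows "\<alpha> \<^bold>\<in> \<beta> \<or> \<alpha> = \<beta> \<or> \<beta> \<^bold>\<in> \<alpha>"
proof -
  let ?P = "\<lambda>\<alpha> \<beta>. \<alpha> \<^bold>\<in> \<beta> \<or> \<alpha> = \<beta> \<or> \<beta> \<^bold>\<in> \<alpha>"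
  have "\<forall>\<beta>. ordinal \<beta> \<longrightarrow> ?P \<alpha> \<beta>"
    using assms(1)
  proof (rule ordinal_induct)
    show "definable (\<lambda>e. \<forall>\<beta>. ordinal \<beta> \<longrightarrow> ?P (e 0) \<beta>)" by (intro dintros)
    fix \<alpha> :: 'a assume \<alpha>: "ordinal \<alpha>"
      and IH: "\<And>\<gamma>. \<gamma> \<^bold>\<in> \<alpha> \<Longrightarrow> \<forall>\<beta>. ordinal \<beta> \<longrightarrow> ?P \<gamma> \<beta>"
    have "?P \<alpha> \<beta>" if "ordinal \<beta>" for \<beta>
      using that
    proof (rule ordinal_induct)
      show "definable (\<lambda>e. ?P \<alpha> (e 0))" by (intro dintros)
      fix \<beta> assume \<beta>: "ordinal \<beta>" and IH': "\<And>\<gamma>. \<gamma> \<^bold>\<in> \<beta> \<Longrightarrow> ?P \<alpha> \<gamma>"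
      show "?P \<alpha> \<beta>"
      proof (rule ccontr)
        assume n: "\<not> ?P \<alpha> \<beta>"
        have "\<alpha> = \<beta>"
        proof (rule set_ext)
          show "is_set \<alpha>" "is_set \<beta>" using \<alpha> \<beta> by (auto intro: ordinal_is_set)
          show "z \<^bold>\<in> \<alpha> \<longleftrightarrow> z \<^bold>\<in> \<beta>" for z
            using IH[of z] IH'[of z] n \<beta> ordinal_trans[OF \<alpha>, of z \<beta>] ordinal_trans[OF \<beta>, of z \<alpha>]
            by blast
        qed
        then show False using n by blast
      qed
    qed
    then show "\<forall>\<beta>. ordinal \<beta> \<longrightarrow> ?P \<alpha> \<beta>" by blast
  qed
  then show ?thesis using assms(2) by blast
qed

lemma osucc_mem_osucc:
  assumes "ordinal \<beta>" "\<alpha> \<^bold>\<in> \<beta>"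
  shows "osucc \<alpha> \<^bold>\<in> osucc \<beta>"
proof -
  have "\<not> \<beta> \<^bold>\<in> osucc \<alpha>" using assms mem_asym by auto
  then show ?thesis using ordinal_linear[of "osucc \<alpha>" \<beta>] assms ordinal_mem[OF assms] by auto
qed

text \<open>A nonzero ordinal that is not a limit has an element \<beta> whose successor is not
  below it, so that successor is the ordinal itself. The successor of \<open>nul\<close> is
  separated because the hierarchy starts at 1.\<close>

lemma ordinal_cases:
  assumes "ordinal \<alpha>" "\<alpha> \<noteq> nul"
  obtains (one) "\<alpha> = osucc nul"
  | (osucc) \<beta> where "\<alpha> = osucc \<beta>" "\<beta> \<noteq> nul" "ordinal \<beta>"
  | (limit) "limit_ordinal \<alpha>"
proof (cases "limit_ordinal \<alpha>")
  case False
  then obtain \<beta> where \<beta>: "\<beta> \<^bold>\<in> \<alpha>" "\<not> osucc \<beta> \<^bold>\<in> \<alpha>" using assms unfolding limit_ordinal_def by blast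
  then have "osucc \<beta> = \<alpha>" using osucc_mem_osucc[OF assms(1)] by auto
  then show thesis using that(1,2) ordinal_mem[OF assms(1) \<beta>(1)] by blast
qed (rule that(3))

lemma limit_not_osucc: "limit_ordinal \<alpha> \<Longrightarrow> \<alpha> \<noteq> osucc \<beta>"
  unfolding limit_ordinal_def using mem_osucc[of \<beta> \<beta>] mem_irrefl[of \<alpha>] by metis

section \<open>The magmatic hierarchy\<close>

text \<open>The recursion clauses with every value \<open>app f \<gamma>\<close> replaced by a
  \<open>k\<close> such that \<open>kpair \<gamma> k\<close> lies in \<open>f\<close>. This avoids
  the description inside \<open>app\<close>, for which there is no definability rule.\<close>

definition magma_step :: "'v::zfa \<Rightarrow> 'v \<Rightarrow> 'v \<Rightarrow> 'v \<Rightarrow> bool" where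
  "magma_step R f \<beta> m \<longleftrightarrow>
     (\<beta> = osucc nul \<longrightarrow> m = magma_base R) \<and>
     (\<forall>\<gamma> k. \<gamma> \<noteq> nul \<longrightarrow> \<beta> = osucc \<gamma> \<longrightarrow> kpair \<gamma> k \<^bold>\<in> f \<longrightarrow> m = magma_next k) \<and>
     (limit_ordinal \<beta> \<longrightarrow>
        m = the_set (\<lambda>x. \<exists>\<delta> k. \<delta> \<^bold>\<in> \<beta> \<and> \<delta> \<noteq> nul \<and> kpair \<delta> k \<^bold>\<in> f \<and> x \<^bold>\<in> k))"

lemma magma_step_cong:
  assumes "\<And>\<delta> k. \<delta> \<^bold>\<in> \<beta> \<Longrightarrow> kpair \<delta> k \<^bold>\<in> f \<longleftrightarrow> kpair \<delta> k \<^bold>\<in> g"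
  shows "magma_step R f \<beta> m \<longleftrightarrow> magma_step R g \<beta> m"
proof -
  have "(\<lambda>x. \<exists>\<delta> k. \<delta> \<^bold>\<in> \<beta> \<and> \<delta> \<noteq> nul \<and> kpair \<delta> k \<^bold>\<in> f \<and> x \<^bold>\<in> k)
      = (\<lambda>x. \<exists>\<delta> k. \<delta> \<^bold>\<in> \<beta> \<and> \<delta> \<noteq> nul \<and> kpair \<delta> k \<^bold>\<in> g \<and> x \<^bold>\<in> k)"
    using assms by (metis (no_types, opaque_lifting))
  moreover have "kpair \<gamma> k \<^bold>\<in> f \<longleftrightarrow> kpair \<gamma> k \<^bold>\<in> g" if "\<beta> = osucc \<gamma>" for \<gamma> k
    using assms that by simp
  ultimately show ?thesis unfolding magma_step_def by presburger
qed

text \<open>By injectivity of successor and the absence of a predecessor for limits, exactly one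
  clause applies, and it determines \<open>m\<close> because \<open>f\<close> is single-valued below
  \<beta>.\<close>

lemma magma_step_ex1:
  assumes "ordinal \<beta>" "\<beta> \<noteq> nul" "\<And>\<delta>. \<delta> \<^bold>\<in> \<beta> \<Longrightarrow> \<delta> \<noteq> nul \<Longrightarrow> \<exists>!k. kpair \<delta> k \<^bold>\<in> f"
  shows "\<exists>!m. magma_step R f \<beta> m"
  using assms(1,2)
proof (cases rule: ordinal_cases)
  case one
  then have "magma_step R f \<beta> m \<longleftrightarrow> m = magma_base R" for m
    unfolding magma_step_def using limit_not_osucc[of \<beta> nul] by auto
  then show ?thesis by simp
next
  case (osucc \<gamma>)
  then have "\<exists>!k. kpair \<gamma> k \<^bold>\<in> f" using assms(3)[of \<gamma>] by simp
  then obtain k where k: "kpair \<gamma> k' \<^bold>\<in> f \<longleftrightarrow> k' = k" for k' by metis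
  have "magma_step R f \<beta> m \<longleftrightarrow> m = magma_next k" for m
    unfolding magma_step_def osucc(1) osucc_inject
    using osucc(2) k limit_not_osucc[of "osucc \<gamma>" \<gamma>] by metis
  then show ?thesis by simp
next
  case limit
  then have "magma_step R f \<beta> m
      \<longleftrightarrow> m = the_set (\<lambda>x. \<exists>\<delta> k. \<delta> \<^bold>\<in> \<beta> \<and> \<delta> \<noteq> nul \<and> kpair \<delta> k \<^bold>\<in> f \<and> x \<^bold>\<in> k)" for m
    unfolding magma_step_def using limit_not_osucc[OF limit] by simp
  then show ?thesis by simp
qed

text \<open>Once \<open>f\<close> is single-valued on its domain, \<open>app f \<beta>\<close> is
  the one \<open>m\<close> paired with \<beta>, so both forms of the recursion agree. If a condition
  on the shape of \<open>f\<close> fails, both sides are false.\<close>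

lemma magma_seq_iff_step:
  assumes "ordinal \<alpha>"
  shows "magma_seq R \<alpha> f \<longleftrightarrow> is_set f \<and>
     (\<forall>p. p \<^bold>\<in> f \<longrightarrow> (\<exists>\<beta> m. \<beta> \<^bold>\<in> osucc \<alpha> \<and> \<beta> \<noteq> nul \<and> p = kpair \<beta> m)) \<and>
     (\<forall>\<beta>. \<beta> \<^bold>\<in> osucc \<alpha> \<and> \<beta> \<noteq> nul \<longrightarrow> (\<exists>!m. kpair \<beta> m \<^bold>\<in> f)) \<and>
     (\<forall>\<beta> m. kpair \<beta> m \<^bold>\<in> f \<longrightarrow> magma_step R f \<beta> m)"
    (is "_ \<longleftrightarrow> ?s \<and> ?d \<and> ?u \<and> ?r")
proof (cases "?s \<and> ?d \<and> ?u")
  case False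
  then show ?thesis unfolding magma_seq_def by argo
next
  case True
  then have d: ?d and u: ?u by auto
  have dom: "\<beta> \<^bold>\<in> osucc \<alpha>" "\<beta> \<noteq> nul" if "kpair \<beta> m \<^bold>\<in> f" for \<beta> m
    using d that by fastforce+
  have app_eq: "app f \<beta> = m" if "kpair \<beta> m \<^bold>\<in> f" for \<beta> m
    unfolding app_def using u dom[OF that] that by (intro the_equality) blast+
  have app_mem: "kpair \<beta> (app f \<beta>) \<^bold>\<in> f" if \<beta>: "\<beta> \<^bold>\<in> osucc \<alpha>" "\<beta> \<noteq> nul" for \<beta>
  proof -
    obtain m where "kpair \<beta> m \<^bold>\<in> f" using u \<beta> by blast
    then show ?thesis using app_eq by simp
  qed
  have o: "ordinal (osucc \<alpha>)" using assms by simp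
  have lim: "(\<lambda>x. \<exists>\<delta>. \<delta> \<^bold>\<in> \<gamma> \<and> \<delta> \<noteq> nul \<and> x \<^bold>\<in> app f \<delta>)
      = (\<lambda>x. \<exists>\<delta> k. \<delta> \<^bold>\<in> \<gamma> \<and> \<delta> \<noteq> nul \<and> kpair \<delta> k \<^bold>\<in> f \<and> x \<^bold>\<in> k)" if "\<gamma> \<^bold>\<in> osucc \<alpha>" for \<gamma>
    using app_eq app_mem ordinal_trans[OF o that] by (metis (no_types, opaque_lifting))
  show ?thesis
  proof
    assume seq: "magma_seq R \<alpha> f"
    then have base: "osucc nul \<^bold>\<in> osucc \<alpha> \<longrightarrow> app f (osucc nul) = magma_base R"
      and succ: "\<forall>\<beta>. \<beta> \<noteq> nul \<and> osucc \<beta> \<^bold>\<in> osucc \<alpha> \<longrightarrow> app f (osucc \<beta>) = magma_next (app f \<beta>)"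
      and limit: "\<forall>\<gamma>. limit_ordinal \<gamma> \<and> \<gamma> \<^bold>\<in> osucc \<alpha> \<longrightarrow>
        app f \<gamma> = the_set (\<lambda>x. \<exists>\<beta>. \<beta> \<^bold>\<in> \<gamma> \<and> \<beta> \<noteq> nul \<and> x \<^bold>\<in> app f \<beta>)"
      unfolding magma_seq_def by - (elim conjE, assumption)+
    have "magma_step R f \<beta> m" if "kpair \<beta> m \<^bold>\<in> f" for \<beta> m
      unfolding magma_step_def
    proof (intro conjI allI impI)
      have m: "m = app f \<beta>" using app_eq that by simp
      have \<beta>: "\<beta> \<^bold>\<in> osucc \<alpha>" "\<beta> \<noteq> nul" using dom that by blast+
      show "m = magma_base R" if "\<beta> = osucc nul"
        using base that \<beta> m by blast
      show "m = magma_next k" if "\<gamma> \<noteq> nul" "\<beta> = osucc \<gamma>" "kpair \<gamma> k \<^bold>\<in> f" for \<gamma> k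
        using succ that \<beta> m app_eq[OF that(3)] by blast
      show "m = the_set (\<lambda>x. \<exists>\<delta> k. \<delta> \<^bold>\<in> \<beta> \<and> \<delta> \<noteq> nul \<and> kpair \<delta> k \<^bold>\<in> f \<and> x \<^bold>\<in> k)"
        if "limit_ordinal \<beta>"
        unfolding lim[OF \<beta>(1), symmetric] m using limit that \<beta>(1) by blast
    qed
    then show "?s \<and> ?d \<and> ?u \<and> ?r" using True by blast
  next
    assume "?s \<and> ?d \<and> ?u \<and> ?r"
    then have r: "magma_step R f \<beta> m" if "kpair \<beta> m \<^bold>\<in> f" for \<beta> m using that by blast
    have "app f (osucc nul) = magma_base R" if "osucc nul \<^bold>\<in> osucc \<alpha>"
      using r[OF app_mem[OF that]] unfolding magma_step_def by simp
    moreover have "app f (osucc \<beta>) = magma_next (app f \<beta>)" if "\<beta> \<noteq> nul" "osucc \<beta> \<^bold>\<in> osucc \<alpha>" for \<beta>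
    proof -
      have "\<beta> \<^bold>\<in> osucc \<alpha>" using ordinal_trans[OF o that(2)] by simp
      then show ?thesis using r[OF app_mem[OF that(2)]] app_mem that(1) unfolding magma_step_def by simp
    qed
    moreover have "app f \<gamma> = the_set (\<lambda>x. \<exists>\<beta>. \<beta> \<^bold>\<in> \<gamma> \<and> \<beta> \<noteq> nul \<and> x \<^bold>\<in> app f \<beta>)"
      if "limit_ordinal \<gamma>" "\<gamma> \<^bold>\<in> osucc \<alpha>" for \<gamma>
    proof -
      have "\<gamma> \<noteq> nul" using that(1) unfolding limit_ordinal_def by blast
      then show ?thesis
        unfolding lim[OF that(2)] using r[OF app_mem[OF that(2)]] that(1) unfolding magma_step_def by blast
    qed
    ultimately show "magma_seq R \<alpha> f" unfolding magma_seq_def using True by (intro conjI allI impI) blast+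
  qed
qed

section \<open>Existence and uniqueness of approximations to the hierarchy\<close>

text \<open>Building ordinality in makes the pairwise characterisation unconditional, so that it can
  serve as a rewriting rule in definability proofs.\<close>

definition oseq :: "'v::zfa \<Rightarrow> 'v \<Rightarrow> 'v \<Rightarrow> bool" where
  "oseq R \<alpha> f \<longleftrightarrow> ordinal \<alpha> \<and> magma_seq R \<alpha> f"

lemma oseq_iff_step:
  "oseq R \<alpha> f \<longleftrightarrow> ordinal \<alpha> \<and> is_set f \<and>
     (\<forall>p. p \<^bold>\<in> f \<longrightarrow> (\<exists>\<beta> m. \<beta> \<^bold>\<in> osucc \<alpha> \<and> \<beta> \<noteq> nul \<and> p = kpair \<beta> m)) \<and>
     (\<forall>\<beta>. \<beta> \<^bold>\<in> osucc \<alpha> \<and> \<beta> \<noteq> nul \<longrightarrow> (\<exists>!m. kpair \<beta> m \<^bold>\<in> f)) \<and>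
     (\<forall>\<beta> m. kpair \<beta> m \<^bold>\<in> f \<longrightarrow> magma_step R f \<beta> m)"
  unfolding oseq_def using magma_seq_iff_step by (rule conj_cong[OF refl])

lemma definable_oseq [dintros]: "dterm F \<Longrightarrow> dterm G \<Longrightarrow> definable (\<lambda>e. oseq R (F e) (G e))"
  by (rule definable_comp2; (assumption)?) (unfold oseq_iff_step magma_step_def, intro dintros)

lemma oseq_ordinal: "oseq R \<alpha> f \<Longrightarrow> ordinal \<alpha>"
  unfolding oseq_def by blast

lemma oseq_dom:
  assumes "oseq R \<alpha> f" "kpair \<beta> m \<^bold>\<in> f"
  shows "\<beta> \<^bold>\<in> osucc \<alpha>" "\<beta> \<noteq> nul"
  using assms unfolding oseq_iff_step by (metis kpair_eq_iff)+

lemma oseq_ex1: "oseq R \<alpha> f \<Longrightarrow> \<beta> \<^bold>\<in> osucc \<alpha> \<Longrightarrow> \<beta> \<noteq> nul \<Longrightarrow> \<exists>!m. kpair \<beta> m \<^bold>\<in> f"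
  unfolding oseq_iff_step by blast

lemma oseq_step: "oseq R \<alpha> f \<Longrightarrow> kpair \<beta> m \<^bold>\<in> f \<Longrightarrow> magma_step R f \<beta> m"
  unfolding oseq_iff_step by blast

lemma oseq_agree:
  assumes f: "oseq R \<alpha> f" and g: "oseq R \<alpha>' g" and "\<beta> \<^bold>\<in> osucc \<alpha>" "\<beta> \<^bold>\<in> osucc \<alpha>'"
  shows "kpair \<beta> m \<^bold>\<in> f \<longleftrightarrow> kpair \<beta> m \<^bold>\<in> g"
proof -
  have o: "ordinal (osucc \<alpha>)" "ordinal (osucc \<alpha>')" using oseq_ordinal[OF f] oseq_ordinal[OF g] by auto
  let ?P = "\<lambda>\<beta>. \<beta> \<^bold>\<in> osucc \<alpha> \<longrightarrow> \<beta> \<^bold>\<in> osucc \<alpha>' \<longrightarrow> (\<forall>m. kpair \<beta> m \<^bold>\<in> f \<longleftrightarrow> kpair \<beta> m \<^bold>\<in> g)"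
  have "ordinal \<beta>" using ordinal_mem[OF o(1)] assms(3) by blast
  then have "?P \<beta>"
  proof (rule ordinal_induct)
    show "definable (\<lambda>e. ?P (e 0))" by (intro dintros)
    fix \<beta> assume \<beta>: "ordinal \<beta>" and IH: "\<And>\<delta>. \<delta> \<^bold>\<in> \<beta> \<Longrightarrow> ?P \<delta>"
    show "?P \<beta>"
    proof (intro impI)
      assume b: "\<beta> \<^bold>\<in> osucc \<alpha>" "\<beta> \<^bold>\<in> osucc \<alpha>'"
      show "\<forall>m. kpair \<beta> m \<^bold>\<in> f \<longleftrightarrow> kpair \<beta> m \<^bold>\<in> g"
      proof (cases "\<beta> = nul")
        case True
        then show ?thesis using oseq_dom(2) f g by blast
      next
        case False
        obtain m where m: "kpair \<beta> m \<^bold>\<in> f" using oseq_ex1[OF f b(1) False] by blast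
        obtain m' where m': "kpair \<beta> m' \<^bold>\<in> g" using oseq_ex1[OF g b(2) False] by blast
        have agree: "kpair \<delta> k \<^bold>\<in> f \<longleftrightarrow> kpair \<delta> k \<^bold>\<in> g" if "\<delta> \<^bold>\<in> \<beta>" for \<delta> k
          using IH[OF that] ordinal_trans[OF o(1) b(1) that] ordinal_trans[OF o(2) b(2) that] by blast
        \<comment> \<open>Since \<open>f\<close> and \<open>g\<close> agree below \<beta>, both
          values satisfy the same step relation, which has only one solution.\<close>
        have "magma_step R f \<beta> m" using oseq_step[OF f m] .
        moreover have "magma_step R f \<beta> m'"
          using oseq_step[OF g m'] magma_step_cong[OF agree, of \<beta> R m'] by blast
        moreover have "\<exists>!m. magma_step R f \<beta> m"
          using \<beta> False oseq_ex1[OF f] ordinal_trans[OF o(1) b(1)] by (intro magma_step_ex1) blast+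
        ultimately have "m = m'" by blast
        then show ?thesis using m m' oseq_ex1[OF f b(1) False] oseq_ex1[OF g b(2) False] by metis
      qed
    qed
  qed
  then show ?thesis using assms(3,4) by blast
qed

lemma oseq_exists:
  assumes "ordinal \<alpha>"
  shows "\<exists>f. oseq R \<alpha> f"
  using assms
proof (rule ordinal_induct)
  show "definable (\<lambda>e. \<exists>f. oseq R (e 0) f)" by (intro dintros)
  fix \<alpha> assume \<alpha>: "ordinal \<alpha>" and IH: "\<And>\<beta>. \<beta> \<^bold>\<in> \<alpha> \<Longrightarrow> \<exists>f. oseq R \<beta> f"
  show "\<exists>f. oseq R \<alpha> f"
  proof (cases "\<alpha> = nul")
    case True
    then have "oseq R \<alpha> nul" unfolding oseq_iff_step by simp
    then show ?thesis ..
  next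
    case False
    \<comment> \<open>Each \<beta> below \<alpha> contributes only the top pair of its
      approximation. Agreement of approximations makes this functional, and \<beta> =
      \<open>nul\<close> contributes nothing.\<close>
    let ?Q = "\<lambda>\<beta> p. \<exists>g m. oseq R \<beta> g \<and> kpair \<beta> m \<^bold>\<in> g \<and> p = kpair \<beta> m"
    have "\<exists>v. \<forall>p. p \<^bold>\<in> v \<longleftrightarrow> (\<exists>\<beta>. \<beta> \<^bold>\<in> \<alpha> \<and> ?Q \<beta> p)"
    proof (rule replacement_definable)
      show "definable (\<lambda>e. ?Q (e 0) (e 1))" by (intro dintros)
      fix \<beta> p q assume "?Q \<beta> p" "?Q \<beta> q"
      then obtain g m h k where *: "oseq R \<beta> g" "kpair \<beta> m \<^bold>\<in> g" "p = kpair \<beta> m"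
          "oseq R \<beta> h" "kpair \<beta> k \<^bold>\<in> h" "q = kpair \<beta> k"
        by blast
      then have "kpair \<beta> k \<^bold>\<in> g" using oseq_agree[of R \<beta> g \<beta> h \<beta> k] by simp
      then show "p = q" using * oseq_ex1[OF *(1)] oseq_dom[OF *(1,2)] by blast
    qed
    then obtain v where v: "\<And>p. p \<^bold>\<in> v \<longleftrightarrow> (\<exists>\<beta>. \<beta> \<^bold>\<in> \<alpha> \<and> ?Q \<beta> p)" by blast
    have v_iff: "kpair \<beta> k \<^bold>\<in> v \<longleftrightarrow> \<beta> \<^bold>\<in> \<alpha> \<and> (\<exists>g. oseq R \<beta> g \<and> kpair \<beta> k \<^bold>\<in> g)" for \<beta> k
      unfolding v by auto
    have v_eq: "kpair \<delta> k \<^bold>\<in> v \<longleftrightarrow> kpair \<delta> k \<^bold>\<in> g" if "oseq R \<beta> g" "\<beta> \<^bold>\<in> \<alpha>" "\<delta> \<^bold>\<in> osucc \<beta>" for \<delta> k \<beta> g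
    proof -
      have "\<delta> \<^bold>\<in> \<alpha>" using that(2,3) ordinal_trans[OF \<alpha>] by auto
      moreover have "kpair \<delta> k \<^bold>\<in> h \<longleftrightarrow> kpair \<delta> k \<^bold>\<in> g" if "oseq R \<delta> h" for h
        using oseq_agree[OF that \<open>oseq R \<beta> g\<close>, of \<delta> k] \<open>\<delta> \<^bold>\<in> osucc \<beta>\<close> by simp
      ultimately show ?thesis unfolding v_iff using IH by blast
    qed
    have v_ex1: "\<exists>!k. kpair \<beta> k \<^bold>\<in> v" if "\<beta> \<^bold>\<in> \<alpha>" "\<beta> \<noteq> nul" for \<beta>
    proof -
      obtain g where g: "oseq R \<beta> g" using IH \<open>\<beta> \<^bold>\<in> \<alpha>\<close> by blast
      show ?thesis using oseq_ex1[OF g, of \<beta>] v_eq[OF g that(1), of \<beta>] that(2) by simp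
    qed
    obtain m where m: "magma_step R v \<alpha> m" using magma_step_ex1[OF \<alpha> False v_ex1] by blast
    \<comment> \<open>The collected pairs cover the ordinals below \<alpha>; one further value,
      given by the step relation, completes the approximation.\<close>
    define f where "f = v \<^bold>\<union> upair (kpair \<alpha> m) (kpair \<alpha> m)"
    have f: "p \<^bold>\<in> f \<longleftrightarrow> p \<^bold>\<in> v \<or> p = kpair \<alpha> m" for p unfolding f_def by simp
    have fv: "kpair \<delta> k \<^bold>\<in> f \<longleftrightarrow> kpair \<delta> k \<^bold>\<in> v" if "\<delta> \<^bold>\<in> \<alpha>" for \<delta> k
      unfolding f using that by auto
    have "oseq R \<alpha> f"
      unfolding oseq_iff_step
    proof (intro conjI allI impI)
      show "ordinal \<alpha>" by fact
      show "is_set f" unfolding f_def by simp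
      show "\<exists>\<beta> m. \<beta> \<^bold>\<in> osucc \<alpha> \<and> \<beta> \<noteq> nul \<and> p = kpair \<beta> m" if "p \<^bold>\<in> f" for p
      proof (cases "p \<^bold>\<in> v")
        case True
        then show ?thesis unfolding v using oseq_dom(2) by (metis mem_osucc)
      next
        case False
        then show ?thesis using that \<open>\<alpha> \<noteq> nul\<close> unfolding f by (metis mem_osucc)
      qed
      show "\<exists>!k. kpair \<beta> k \<^bold>\<in> f" if "\<beta> \<^bold>\<in> osucc \<alpha> \<and> \<beta> \<noteq> nul" for \<beta>
      proof (cases "\<beta> = \<alpha>")
        case True
        then show ?thesis unfolding f v_iff by simp
      next
        case False
        then show ?thesis using fv[of \<beta>] v_ex1[of \<beta>] that by simp
      qed
      show "magma_step R f \<beta> k" if "kpair \<beta> k \<^bold>\<in> f" for \<beta> k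
      proof (cases "\<beta> = \<alpha>")
        case True
        then have "k = m" using that unfolding f v_iff by simp
        then show ?thesis using m True magma_step_cong[OF fv, of \<alpha> R m] by blast
      next
        case False
        then have k: "kpair \<beta> k \<^bold>\<in> v" using that unfolding f by simp
        then obtain g where g: "\<beta> \<^bold>\<in> \<alpha>" "oseq R \<beta> g" "kpair \<beta> k \<^bold>\<in> g" unfolding v_iff by blast
        have "kpair \<delta> j \<^bold>\<in> f \<longleftrightarrow> kpair \<delta> j \<^bold>\<in> g" if "\<delta> \<^bold>\<in> \<beta>" for \<delta> j
          using fv[OF ordinal_trans[OF \<alpha> g(1) that]] v_eq[OF g(2,1), of \<delta>] that by simp
        then show ?thesis using magma_step_cong[of \<beta> f g R k] oseq_step[OF g(2,3)] by blast
      qed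
    qed
    then show ?thesis ..
  qed
qed

text \<open>Connects the description in \<open>magma_level\<close> with arbitrary approximations:
  the one of length \<delta> is unique, and every longer one agrees with it at \<delta>.\<close>

lemma oseq_level:
  assumes f: "oseq R \<alpha> f" and "\<delta> \<^bold>\<in> osucc \<alpha>" "\<delta> \<noteq> nul"
  shows "kpair \<delta> k \<^bold>\<in> f \<longleftrightarrow> k = magma_level R \<delta>"
proof -
  have "ordinal \<delta>" using assms(2) ordinal_mem[of "osucc \<alpha>" \<delta>] oseq_ordinal[OF f] by simp
  then obtain g where g: "oseq R \<delta> g" using oseq_exists by blast
  have "h = g" if h: "oseq R \<delta> h" for h
  proof (rule set_ext)
    show "is_set h" "is_set g" using g h unfolding oseq_iff_step by blast+
    have "p \<^bold>\<in> b" if ab: "oseq R \<delta> a" "oseq R \<delta> b" "p \<^bold>\<in> a" for p a b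
    proof -
      obtain \<beta> m where "\<beta> \<^bold>\<in> osucc \<delta>" "p = kpair \<beta> m" using ab(1,3) unfolding oseq_iff_step by blast
      then show ?thesis using oseq_agree[OF ab(1,2)] ab(3) by blast
    qed
    then show "z \<^bold>\<in> h \<longleftrightarrow> z \<^bold>\<in> g" for z using g h by blast
  qed
  then have "(THE f. magma_seq R \<delta> f) = g"
    using g \<open>ordinal \<delta>\<close> unfolding oseq_def by (intro the_equality) blast+
  then have level: "magma_level R \<delta> = app g \<delta>" unfolding magma_level_def by simp
  have ex1: "\<exists>!m. kpair \<delta> m \<^bold>\<in> g" using oseq_ex1[OF g _ assms(3)] by simp
  have "kpair \<delta> k \<^bold>\<in> f \<longleftrightarrow> kpair \<delta> k \<^bold>\<in> g" using oseq_agree[OF f g assms(2)] by simp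
  also have "\<dots> \<longleftrightarrow> k = app g \<delta>"
    using ex1 theI'[OF ex1] unfolding app_def by blast
  finally show ?thesis unfolding level .
qed

lemma magma_step_level:
  assumes "ordinal \<alpha>" "\<alpha> \<noteq> nul"
  obtains f where "oseq R \<alpha> f" "magma_step R f \<alpha> (magma_level R \<alpha>)"
proof -
  obtain f where f: "oseq R \<alpha> f" using oseq_exists assms(1) by blast
  then have "kpair \<alpha> (magma_level R \<alpha>) \<^bold>\<in> f" using oseq_level[OF f] assms(2) by simp
  then show thesis using that f oseq_step by blast
qed

lemma magma_level_one: "magma_level R (osucc nul) = magma_base R"
  by (rule magma_step_level[of "osucc nul" R]) (auto simp: magma_step_def)

lemma magma_level_osucc:
  assumes "ordinal \<alpha>" "\<alpha> \<noteq> nul"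
  shows "magma_level R (osucc \<alpha>) = magma_next (magma_level R \<alpha>)"
proof (rule magma_step_level[of "osucc \<alpha>" R])
  fix f assume f: "oseq R (osucc \<alpha>) f" "magma_step R f (osucc \<alpha>) (magma_level R (osucc \<alpha>))"
  have "kpair \<alpha> (magma_level R \<alpha>) \<^bold>\<in> f" using oseq_level[OF f(1)] assms(2) by simp
  then show ?thesis using f(2) assms(2) unfolding magma_step_def by blast
qed (use assms in simp_all)

lemma magma_level_limit:
  assumes "limit_ordinal \<gamma>"
  shows "magma_level R \<gamma> = the_set (\<lambda>x. \<exists>\<delta>. \<delta> \<^bold>\<in> \<gamma> \<and> \<delta> \<noteq> nul \<and> x \<^bold>\<in> magma_level R \<delta>)"
proof (rule magma_step_level[of \<gamma> R])
  fix f assume f: "oseq R \<gamma> f" "magma_step R f \<gamma> (magma_level R \<gamma>)"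
  have "(\<exists>\<delta> k. \<delta> \<^bold>\<in> \<gamma> \<and> \<delta> \<noteq> nul \<and> kpair \<delta> k \<^bold>\<in> f \<and> x \<^bold>\<in> k)
      \<longleftrightarrow> (\<exists>\<delta>. \<delta> \<^bold>\<in> \<gamma> \<and> \<delta> \<noteq> nul \<and> x \<^bold>\<in> magma_level R \<delta>)" for x
    using oseq_level[OF f(1)] by (metis mem_osucc)
  then show ?thesis using f(2) assms unfolding magma_step_def by simp
qed (use assms in \<open>simp_all add: limit_ordinal_def\<close>)

section \<open>Levels as sets and membership in them\<close>

definition in_level :: "'v::zfa \<Rightarrow> 'v \<Rightarrow> 'v \<Rightarrow> bool" where
  "in_level R \<alpha> x \<longleftrightarrow> ordinal \<alpha> \<and> \<alpha> \<noteq> nul \<and> x \<^bold>\<in> magma_level R \<alpha>"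

lemma in_level_iff_oseq:
  "in_level R \<alpha> x \<longleftrightarrow> \<alpha> \<noteq> nul \<and> (\<exists>f m. oseq R \<alpha> f \<and> kpair \<alpha> m \<^bold>\<in> f \<and> x \<^bold>\<in> m)"
proof (cases "ordinal \<alpha> \<and> \<alpha> \<noteq> nul")
  case True
  then obtain f where f: "oseq R \<alpha> f" using oseq_exists by blast
  have "kpair \<alpha> m \<^bold>\<in> g \<longleftrightarrow> m = magma_level R \<alpha>" if "oseq R \<alpha> g" for g m
    using oseq_level[OF that] True by simp
  then show ?thesis unfolding in_level_def using f True by metis
next
  case False
  then show ?thesis unfolding in_level_def using oseq_ordinal by blast
qed

lemma definable_in_level [dintros]: "dterm F \<Longrightarrow> dterm G \<Longrightarrow> definable (\<lambda>e. in_level R (F e) (G e))"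
  by (rule definable_comp2; (assumption)?) (unfold in_level_iff_oseq, intro dintros)

lemma magmas_iff: "x \<in> magmas R \<longleftrightarrow> (\<exists>\<alpha>. in_level R \<alpha> x)"
  unfolding magmas_def in_level_def by simp

lemma definable_magmas [dintros]: "dterm F \<Longrightarrow> definable (\<lambda>e. F e \<in> magmas R)"
  by (rule definable_comp1; (assumption)?) (unfold magmas_iff, intro dintros)

lemma definable_atom_le [dintros]: "dterm F \<Longrightarrow> dterm G \<Longrightarrow> definable (\<lambda>e. atom_le R (F e) (G e))"
  unfolding atom_le_def by (intro dintros)

lemma subset_separation:
  assumes "definable (\<lambda>e. P (e 0))"
  shows "\<exists>v. \<forall>x. x \<^bold>\<in> v \<longleftrightarrow> x \<^bold>\<subseteq> m \<and> P x"
proof -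
  obtain u where u: "\<forall>y. y \<^bold>\<in> u \<longleftrightarrow> \<not> y \<^bold>\<in> atoms \<and> (\<forall>z. z \<^bold>\<in> y \<longrightarrow> z \<^bold>\<in> m)"
    using powerset by blast
  \<comment> \<open>The subset condition is kept in the separated predicate: if \<open>m\<close> is
    an atom, the power set axiom still admits \<open>nul\<close>, which is not a subset of
    \<open>m\<close> in the sense that requires both sides to be sets.\<close>
  have "definable (\<lambda>e. e 0 \<^bold>\<subseteq> m \<and> P (e 0))" using assms by (intro dintros)
  then have "\<exists>v. \<forall>x. x \<^bold>\<in> v \<longleftrightarrow> x \<^bold>\<in> u \<and> x \<^bold>\<subseteq> m \<and> P x" by (rule separation_definable)
  moreover have "x \<^bold>\<in> u" if "x \<^bold>\<subseteq> m" for x using u that unfolding subset_of_def is_set_def by blast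
  ultimately show ?thesis by metis
qed

lemma ex_magma_base:
  "\<exists>v. \<forall>x. x \<^bold>\<in> v \<longleftrightarrow> x \<^bold>\<subseteq> atoms \<and> x \<noteq> nul \<and>
     (\<forall>a b. a \<^bold>\<in> x \<longrightarrow> b \<^bold>\<in> atoms \<longrightarrow> atom_le R b a \<longrightarrow> b \<^bold>\<in> x)"
  by (rule subset_separation) (intro dintros)

lemma ex_magma_next:
  "\<exists>v. \<forall>x. x \<^bold>\<in> v \<longleftrightarrow> x \<^bold>\<subseteq> m \<and> x \<noteq> nul \<and>
     (\<forall>y z. y \<^bold>\<in> x \<longrightarrow> z \<^bold>\<in> m \<longrightarrow> z \<^bold>\<subseteq> y \<longrightarrow> z \<^bold>\<in> x)"
  by (rule subset_separation) (intro dintros)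

lemma ex_magma_limit:
  assumes "limit_ordinal \<gamma>"
  shows "\<exists>v. \<forall>x. x \<^bold>\<in> v \<longleftrightarrow> (\<exists>\<delta>. \<delta> \<^bold>\<in> \<gamma> \<and> \<delta> \<noteq> nul \<and> x \<^bold>\<in> magma_level R \<delta>)"
proof -
  \<comment> \<open>The graph of the level function, expressed through approximations so that
    Replacement can collect the levels below the limit. Their union is the desired set.\<close>
  let ?P = "\<lambda>\<delta> k. \<delta> \<noteq> nul \<and> (\<exists>f. oseq R \<delta> f \<and> kpair \<delta> k \<^bold>\<in> f)"
  have P: "?P \<delta> k \<longleftrightarrow> \<delta> \<noteq> nul \<and> k = magma_level R \<delta>" if "\<delta> \<^bold>\<in> \<gamma>" for \<delta> k
  proof -
    have "ordinal \<delta>" using assms that ordinal_mem unfolding limit_ordinal_def by blast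
    then obtain f where "oseq R \<delta> f" using oseq_exists by blast
    moreover have "kpair \<delta> k \<^bold>\<in> f \<longleftrightarrow> k = magma_level R \<delta>" if "oseq R \<delta> f" "\<delta> \<noteq> nul" for f
      using oseq_level[OF that(1) _ that(2)] by simp
    ultimately show ?thesis by blast
  qed
  have "\<exists>w. \<forall>k. k \<^bold>\<in> w \<longleftrightarrow> (\<exists>\<delta>. \<delta> \<^bold>\<in> \<gamma> \<and> ?P \<delta> k)"
  proof (rule replacement_definable)
    show "definable (\<lambda>e. ?P (e 0) (e 1))" by (intro dintros)
    show "k = k'" if "\<delta> \<^bold>\<in> \<gamma>" "?P \<delta> k" "?P \<delta> k'" for \<delta> k k' using that(2,3) unfolding P[OF that(1)] by simp
  qed
  then obtain w where w: "\<And>k. k \<^bold>\<in> w \<longleftrightarrow> (\<exists>\<delta>. \<delta> \<^bold>\<in> \<gamma> \<and> ?P \<delta> k)" by blast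
  have "k \<^bold>\<in> w \<longleftrightarrow> (\<exists>\<delta>. \<delta> \<^bold>\<in> \<gamma> \<and> \<delta> \<noteq> nul \<and> k = magma_level R \<delta>)" for k
    unfolding w using P by blast
  then show ?thesis using ex_Union[of w] by (metis (no_types, lifting))
qed

lemma is_set_magma_level:
  assumes "ordinal \<alpha>" "\<alpha> \<noteq> nul"
  shows "is_set (magma_level R \<alpha>)"
  using assms
proof (cases rule: ordinal_cases)
  case one
  then show ?thesis
    unfolding one magma_level_one magma_base_def by (intro is_set_the_set ex_magma_base)
next
  case (osucc \<beta>)
  show ?thesis
    unfolding osucc(1) magma_level_osucc[OF osucc(3,2)] magma_next_def
    by (intro is_set_the_set ex_magma_next)
next
  case limit
  show ?thesis
    unfolding magma_level_limit[OF limit] by (intro is_set_the_set ex_magma_limit limit)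
qed

lemma in_level_one:
  "in_level R (osucc nul) x \<longleftrightarrow> x \<^bold>\<subseteq> atoms \<and> x \<noteq> nul \<and>
     (\<forall>a b. a \<^bold>\<in> x \<longrightarrow> b \<^bold>\<in> atoms \<longrightarrow> atom_le R b a \<longrightarrow> b \<^bold>\<in> x)"
  unfolding in_level_def magma_level_one magma_base_def mem_the_set[OF ex_magma_base] by simp

lemma in_level_osucc:
  assumes "ordinal \<alpha>" "\<alpha> \<noteq> nul"
  shows "in_level R (osucc \<alpha>) x \<longleftrightarrow> is_set x \<and> x \<noteq> nul \<and> (\<forall>y. y \<^bold>\<in> x \<longrightarrow> in_level R \<alpha> y) \<and>
     (\<forall>y z. y \<^bold>\<in> x \<longrightarrow> in_level R \<alpha> z \<longrightarrow> z \<^bold>\<subseteq> y \<longrightarrow> z \<^bold>\<in> x)"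
  unfolding in_level_def magma_level_osucc[OF assms] magma_next_def mem_the_set[OF ex_magma_next]
    subset_of_def[of x] using assms is_set_magma_level[OF assms] by (simp add: conj_ac)

lemma in_level_limit:
  assumes "limit_ordinal \<gamma>"
  shows "in_level R \<gamma> x \<longleftrightarrow> (\<exists>\<delta>. \<delta> \<^bold>\<in> \<gamma> \<and> in_level R \<delta> x)"
proof -
  have "ordinal \<gamma>" "\<gamma> \<noteq> nul" using assms unfolding limit_ordinal_def by auto
  then show ?thesis
    unfolding in_level_def magma_level_limit[OF assms] mem_the_set[OF ex_magma_limit[OF assms]]
    using ordinal_mem by blast
qed

lemma in_level_ordinal: "in_level R \<alpha> x \<Longrightarrow> ordinal \<alpha>"
  unfolding in_level_def by blast

text \<open>Limit levels contribute no new elements, so descending through them ends at level one or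
  at a successor. The second fact in each case carries conclusions back up to level \<alpha>, and
  the bound on \<gamma> makes the case usable in inductions.\<close>

lemma in_level_cases:
  assumes "in_level R \<alpha> x"
  obtains (one) "in_level R (osucc nul) x" "\<And>y. in_level R (osucc nul) y \<Longrightarrow> in_level R \<alpha> y"
  | (osucc) \<gamma> where "\<gamma> \<^bold>\<in> \<alpha>" "\<gamma> \<noteq> nul" "ordinal \<gamma>" "in_level R (osucc \<gamma>) x"
      "\<And>y. in_level R (osucc \<gamma>) y \<Longrightarrow> in_level R \<alpha> y"
proof -
  let ?P = "\<lambda>\<alpha>. \<forall>x. in_level R \<alpha> x \<longrightarrow>
      in_level R (osucc nul) x \<and> (\<forall>y. in_level R (osucc nul) y \<longrightarrow> in_level R \<alpha> y) \<or>
      (\<exists>\<gamma>. \<gamma> \<^bold>\<in> \<alpha> \<and> \<gamma> \<noteq> nul \<and> in_level R (osucc \<gamma>) x \<and>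
        (\<forall>y. in_level R (osucc \<gamma>) y \<longrightarrow> in_level R \<alpha> y))"
  have "?P \<alpha>"
    using in_level_ordinal[OF assms]
  proof (rule ordinal_induct)
    show "definable (\<lambda>e. ?P (e 0))" by (intro dintros)
    fix \<alpha> assume \<alpha>: "ordinal \<alpha>" and IH: "\<And>\<beta>. \<beta> \<^bold>\<in> \<alpha> \<Longrightarrow> ?P \<beta>"
    show "?P \<alpha>"
    proof (cases "\<alpha> = nul")
      case True
      then show ?thesis unfolding in_level_def by blast
    next
      case False
      with \<alpha> show ?thesis
      proof (cases rule: ordinal_cases)
        case one
        then show ?thesis by blast
      next
        case (osucc \<gamma>)
        then have "\<gamma> \<^bold>\<in> \<alpha>" by simp
        then show ?thesis using osucc by blast
      next
        case limit
        show ?thesis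
        proof (intro allI impI)
          fix x assume "in_level R \<alpha> x"
          then obtain \<beta> where \<beta>: "\<beta> \<^bold>\<in> \<alpha>" "in_level R \<beta> x" unfolding in_level_limit[OF limit] by blast
          have up: "in_level R \<alpha> y" if "in_level R \<beta> y" for y
            unfolding in_level_limit[OF limit] using \<beta>(1) that by blast
          have trans: "\<gamma> \<^bold>\<in> \<alpha>" if "\<gamma> \<^bold>\<in> \<beta>" for \<gamma> using ordinal_trans[OF \<alpha> \<beta>(1) that] .
          show "in_level R (osucc nul) x \<and> (\<forall>y. in_level R (osucc nul) y \<longrightarrow> in_level R \<alpha> y) \<or>
            (\<exists>\<gamma>. \<gamma> \<^bold>\<in> \<alpha> \<and> \<gamma> \<noteq> nul \<and> in_level R (osucc \<gamma>) x \<and>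
              (\<forall>y. in_level R (osucc \<gamma>) y \<longrightarrow> in_level R \<alpha> y))"
            using IH[OF \<beta>(1), THEN spec, of x, THEN mp, OF \<beta>(2)] up trans by blast
        qed
      qed
    qed
  qed
  then show thesis using assms that ordinal_osuccD in_level_ordinal by metis
qed

lemma magma_is_set:
  assumes "x \<in> magmas R"
  shows "is_set x" "x \<noteq> nul"
proof -
  obtain \<alpha> where "in_level R \<alpha> x" using assms unfolding magmas_iff by blast
  then have "is_set x \<and> x \<noteq> nul"
  proof (cases rule: in_level_cases)
    case one
    then show ?thesis unfolding in_level_one subset_of_def by blast
  next
    case (osucc \<gamma>)
    then show ?thesis using in_level_osucc[OF osucc(3,2)] by blast
  qed
  then show "is_set x" "x \<noteq> nul" by auto
qed

lemma in_level_magmas: "in_level R \<alpha> x \<Longrightarrow> x \<in> magmas R"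
  unfolding magmas_iff by blast

section \<open>Levels are closed under included magmas\<close>

text \<open>Both sets are nonempty, but the elements of \<open>x\<close> are atoms and those of
  \<open>y\<close> are magmas, hence sets.\<close>

lemma level_one_not_subset_osucc:
  assumes "in_level R (osucc nul) x" "in_level R (osucc \<gamma>) y" "\<gamma> \<noteq> nul"
  shows "\<not> x \<^bold>\<subseteq> y" "\<not> y \<^bold>\<subseteq> x"
proof -
  have \<gamma>: "ordinal \<gamma>" using assms(2) in_level_ordinal ordinal_osuccD by blast
  have x: "is_set x" "x \<noteq> nul" "z \<^bold>\<in> x \<Longrightarrow> z \<^bold>\<in> atoms" for z
    using assms(1) unfolding in_level_one subset_of_def by blast+
  have y: "is_set y" "y \<noteq> nul" using assms(2) in_level_magmas magma_is_set by blast+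
  have "\<not> z \<^bold>\<in> atoms" if "z \<^bold>\<in> y" for z
  proof -
    have "in_level R \<gamma> z" using assms(2) that unfolding in_level_osucc[OF \<gamma> assms(3)] by blast
    then show ?thesis using magma_is_set(1)[OF in_level_magmas] unfolding is_set_def by blast
  qed
  then show "\<not> x \<^bold>\<subseteq> y" "\<not> y \<^bold>\<subseteq> x"
    using nonempty_set[OF x(1,2)] nonempty_set[OF y] x(3) unfolding subset_of_def by metis+
qed

text \<open>The two conclusions are proved together, because the successor step exchanges the roles
  of \<open>x\<close> and \<open>y\<close>.\<close>

lemma in_level_subset_both:
  assumes "in_level R \<alpha> x" "in_level R \<beta> y"
  shows "(y \<^bold>\<subseteq> x \<longrightarrow> in_level R \<alpha> y) \<and> (x \<^bold>\<subseteq> y \<longrightarrow> in_level R \<beta> x)"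
proof -
  let ?P = "\<lambda>\<alpha>. \<forall>\<beta> x y. in_level R \<alpha> x \<longrightarrow> in_level R \<beta> y \<longrightarrow>
      (y \<^bold>\<subseteq> x \<longrightarrow> in_level R \<alpha> y) \<and> (x \<^bold>\<subseteq> y \<longrightarrow> in_level R \<beta> x)"
  have "?P \<alpha>"
    using in_level_ordinal[OF assms(1)]
  proof (rule ordinal_induct)
    show "definable (\<lambda>e. ?P (e 0))" by (intro dintros)
    fix \<alpha> assume \<alpha>: "ordinal \<alpha>" and IH: "\<And>\<beta>. \<beta> \<^bold>\<in> \<alpha> \<Longrightarrow> ?P \<beta>"
    show "?P \<alpha>"
    proof (intro allI impI)
      fix \<beta> x y assume x: "in_level R \<alpha> x" and y: "in_level R \<beta> y"
      from x show "(y \<^bold>\<subseteq> x \<longrightarrow> in_level R \<alpha> y) \<and> (x \<^bold>\<subseteq> y \<longrightarrow> in_level R \<beta> x)"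
      proof (cases rule: in_level_cases)
        case x1: one
        from y show ?thesis
        proof (cases rule: in_level_cases)
          case y1: one
          then show ?thesis using x1 by blast
        next
          case (osucc \<delta>)
          then show ?thesis using level_one_not_subset_osucc x1(1) by blast
        qed
      next
        case xs: (osucc \<gamma>)
        from y show ?thesis
        proof (cases rule: in_level_cases)
          case one
          then show ?thesis using level_one_not_subset_osucc xs(2,4) by blast
        next
          case ys: (osucc \<delta>)
          note xl = xs(4)[unfolded in_level_osucc[OF xs(3,2)]]
          note yl = ys(4)[unfolded in_level_osucc[OF ys(3,2)]]
          \<comment> \<open>Only the level of \<open>x\<close> has to decrease. The level of
            \<open>y\<close> is universally quantified in the induction hypothesis, so a single
            induction suffices.\<close>
          note IH\<gamma> = IH[OF xs(1), rule_format]
          have "in_level R (osucc \<gamma>) y" if "y \<^bold>\<subseteq> x"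
            unfolding in_level_osucc[OF xs(3,2)]
          proof (intro conjI allI impI)
            show "is_set y" "y \<noteq> nul" using yl by blast+
            show "in_level R \<gamma> w" if "w \<^bold>\<in> y" for w
              using that \<open>y \<^bold>\<subseteq> x\<close> xl unfolding subset_of_def by blast
            show "z \<^bold>\<in> y" if "w \<^bold>\<in> y" "in_level R \<gamma> z" "z \<^bold>\<subseteq> w" for w z
            proof -
              have "in_level R \<delta> w" using yl that(1) by blast
              then have "in_level R \<delta> z" using IH\<gamma>[OF that(2)] that(3) by blast
              then show ?thesis using yl that by blast
            qed
          qed
          moreover have "in_level R (osucc \<delta>) x" if "x \<^bold>\<subseteq> y"
            unfolding in_level_osucc[OF ys(3,2)]
          proof (intro conjI allI impI)
            show "is_set x" "x \<noteq> nul" using xl by blast+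
            show "in_level R \<delta> w" if "w \<^bold>\<in> x" for w
              using that \<open>x \<^bold>\<subseteq> y\<close> yl unfolding subset_of_def by blast
            show "z \<^bold>\<in> x" if "w \<^bold>\<in> x" "in_level R \<delta> z" "z \<^bold>\<subseteq> w" for w z
            proof -
              have "in_level R \<gamma> w" using xl that(1) by blast
              then have "in_level R \<gamma> z" using IH\<gamma>[OF _ that(2)] that(3) by blast
              then show ?thesis using xl that by blast
            qed
          qed
          ultimately show ?thesis using xs(5) ys(5) by blast
        qed
      qed
    qed
  qed
  then show ?thesis using assms by blast
qed

lemma in_level_subset:
  assumes "in_level R \<alpha> x" "y \<in> magmas R" "y \<^bold>\<subseteq> x"
  shows "in_level R \<alpha> y"
proof -
  obtain \<beta> where "in_level R \<beta> y" using assms(2) unfolding magmas_iff by blast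
  then show ?thesis using in_level_subset_both[OF assms(1)] assms(3) by blast
qed

section \<open>Limit ordinals above a given ordinal\<close>

text \<open>\<open>shift_by \<alpha> n \<beta>\<close> says \<open>\<beta> = \<alpha> + n\<close> for finite \<open>n\<close>; the witness \<open>f\<close> is a derivation of this
  fact from \<open>\<alpha> + 0 = \<alpha>\<close> and \<open>\<alpha> + Suc n = Suc (\<alpha> + n)\<close>, so it need not be a function.\<close>

definition shift_by :: "'v::zfa \<Rightarrow> 'v \<Rightarrow> 'v \<Rightarrow> bool" where
  "shift_by \<alpha> n \<beta> \<longleftrightarrow> (\<exists>f. kpair n \<beta> \<^bold>\<in> f \<and> (\<forall>k \<gamma>. kpair k \<gamma> \<^bold>\<in> f \<longrightarrow>
     k = nul \<and> \<gamma> = \<alpha> \<or> (\<exists>k' \<gamma>'. k = osucc k' \<and> \<gamma> = osucc \<gamma>' \<and> kpair k' \<gamma>' \<^bold>\<in> f)))"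

lemma definable_shift_by [dintros]:
  "dterm F \<Longrightarrow> dterm G \<Longrightarrow> definable (\<lambda>e. shift_by \<alpha> (F e) (G e))"
  by (rule definable_comp2; (assumption)?) (unfold shift_by_def, intro dintros)

lemma shift_by_cases:
  assumes "shift_by \<alpha> n \<beta>"
  obtains "n = nul" "\<beta> = \<alpha>" | k \<gamma> where "n = osucc k" "\<beta> = osucc \<gamma>" "shift_by \<alpha> k \<gamma>"
  using assms unfolding shift_by_def by metis

lemma shift_by_nul: "shift_by \<alpha> nul \<alpha>"
  unfolding shift_by_def by (rule exI[of _ "upair (kpair nul \<alpha>) (kpair nul \<alpha>)"]) simp

lemma shift_by_osucc:
  assumes "shift_by \<alpha> n \<beta>"
  shows "shift_by \<alpha> (osucc n) (osucc \<beta>)"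
proof -
  obtain f where f: "kpair n \<beta> \<^bold>\<in> f" "\<And>k \<gamma>. kpair k \<gamma> \<^bold>\<in> f \<Longrightarrow>
     k = nul \<and> \<gamma> = \<alpha> \<or> (\<exists>k' \<gamma>'. k = osucc k' \<and> \<gamma> = osucc \<gamma>' \<and> kpair k' \<gamma>' \<^bold>\<in> f)"
    using assms unfolding shift_by_def by blast
  let ?p = "kpair (osucc n) (osucc \<beta>)"
  show ?thesis
    unfolding shift_by_def
  proof (intro exI[of _ "f \<^bold>\<union> upair ?p ?p"] conjI allI impI)
    fix k \<gamma> assume "kpair k \<gamma> \<^bold>\<in> f \<^bold>\<union> upair ?p ?p"
    then have "kpair k \<gamma> \<^bold>\<in> f \<or> k = osucc n \<and> \<gamma> = osucc \<beta>" by simp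
    then show "k = nul \<and> \<gamma> = \<alpha> \<or>
      (\<exists>k' \<gamma>'. k = osucc k' \<and> \<gamma> = osucc \<gamma>' \<and> kpair k' \<gamma>' \<^bold>\<in> f \<^bold>\<union> upair ?p ?p)"
      unfolding mem_un using f by metis
  qed simp
qed

text \<open>This is the single-valuedness that Replacement needs. The last step of a derivation is
  determined by \<open>n\<close>: zero is not a successor, and successor is injective.\<close>

lemma shift_by_functional:
  assumes "ordinal n" "shift_by \<alpha> n \<beta>" "shift_by \<alpha> n \<beta>'"
  shows "\<beta> = \<beta>'"
proof -
  let ?P = "\<lambda>n. \<forall>\<beta> \<beta>'. shift_by \<alpha> n \<beta> \<longrightarrow> shift_by \<alpha> n \<beta>' \<longrightarrow> \<beta> = \<beta>'"
  have "?P n"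
    using assms(1)
  proof (rule ordinal_induct)
    show "definable (\<lambda>e. ?P (e 0))" by (intro dintros)
    fix n assume IH: "\<And>k. k \<^bold>\<in> n \<Longrightarrow> ?P k"
    show "?P n"
    proof (intro allI impI)
      fix \<beta> \<beta>' assume b: "shift_by \<alpha> n \<beta>" "shift_by \<alpha> n \<beta>'"
      from b(1) show "\<beta> = \<beta>'"
      proof (cases rule: shift_by_cases)
        case 1
        then show ?thesis using b(2) by (auto elim: shift_by_cases)
      next
        case (2 k \<gamma>)
        obtain \<gamma>' where "\<beta>' = osucc \<gamma>'" "shift_by \<alpha> k \<gamma>'"
          using b(2) unfolding 2(1) by (rule shift_by_cases) auto
        moreover have "k \<^bold>\<in> n" using 2(1) by simp
        ultimately show ?thesis using 2 IH by blast
      qed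
    qed
  qed
  then show ?thesis using assms(2,3) by blast
qed

text \<open>The limit is the union of \<alpha>, \<alpha> + 1, \<alpha> + 2 and so on, obtained by
  Replacement from an inductive set.\<close>

lemma limit_ordinal_above:
  fixes \<alpha> :: "'v::zfa"
  assumes "ordinal \<alpha>"
  shows "\<exists>\<gamma>. limit_ordinal \<gamma> \<and> \<alpha> \<^bold>\<in> \<gamma>"
proof -
  obtain s :: 'v where s: "nul \<^bold>\<in> s"
    "\<And>x. x \<^bold>\<in> s \<Longrightarrow> \<exists>y. y \<^bold>\<in> s \<and> (\<forall>z. z \<^bold>\<in> y \<longleftrightarrow> z \<^bold>\<in> x \<or> z = x)"
    using infinity by blast
  have s_osucc: "osucc x \<^bold>\<in> s" if x: "x \<^bold>\<in> s" for x
  proof -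
    obtain y where y: "y \<^bold>\<in> s" "\<And>z. z \<^bold>\<in> y \<longleftrightarrow> z \<^bold>\<in> x \<or> z = x" using s(2)[OF x] by blast
    \<comment> \<open>The axiom of infinity only prescribes the elements of \<open>y\<close>; having
      the element \<open>x\<close> makes it a set and so identifies it with
      \<open>osucc x\<close>.\<close>
    then have "is_set y" using is_setI[of x y] by blast
    then have "y = osucc x" by (rule set_ext) (simp_all add: y(2))
    then show ?thesis using y(1) by simp
  qed
  \<comment> \<open>The inductive set may contain elements that are not ordinals. Requiring
    \<open>n\<close> to be an ordinal permits the induction behind single-valuedness, and requiring
    it of \<beta> makes the image a set of ordinals.\<close>
  let ?P = "\<lambda>n \<beta>. ordinal n \<and> ordinal \<beta> \<and> shift_by \<alpha> n \<beta>"
  have "\<exists>v. \<forall>\<beta>. \<beta> \<^bold>\<in> v \<longleftrightarrow> (\<exists>n. n \<^bold>\<in> s \<and> ?P n \<beta>)"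
  proof (rule replacement_definable)
    show "definable (\<lambda>e. ?P (e 0) (e 1))" by (intro dintros)
  qed (use shift_by_functional in blast)
  then obtain v where v: "\<And>\<beta>. \<beta> \<^bold>\<in> v \<longleftrightarrow> (\<exists>n. n \<^bold>\<in> s \<and> ?P n \<beta>)" by blast
  have v_osucc: "osucc \<beta> \<^bold>\<in> v" if "\<beta> \<^bold>\<in> v" for \<beta>
    using that shift_by_osucc s_osucc ordinal_osucc unfolding v by blast
  have "\<alpha> \<^bold>\<in> v" unfolding v using s(1) ordinal_nul assms shift_by_nul by blast
  then have "osucc \<alpha> \<^bold>\<in> v" by (rule v_osucc)
  define \<gamma> where "\<gamma> = the_set (\<lambda>z. \<exists>y. y \<^bold>\<in> v \<and> z \<^bold>\<in> y)"
  have \<gamma>: "is_set \<gamma>" "\<And>z. z \<^bold>\<in> \<gamma> \<longleftrightarrow> (\<exists>y. y \<^bold>\<in> v \<and> z \<^bold>\<in> y)"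
    unfolding \<gamma>_def by (rule is_set_the_set[OF ex_Union] mem_the_set[OF ex_Union])+
  have v_ord: "ordinal \<beta>" if "\<beta> \<^bold>\<in> v" for \<beta> using that unfolding v by blast
  have "\<alpha> \<^bold>\<in> \<gamma>" unfolding \<gamma>(2) using \<open>osucc \<alpha> \<^bold>\<in> v\<close> mem_osucc[of \<alpha> \<alpha>] by blast
  moreover have "ordinal \<gamma>"
  proof -
    have "transitive_set \<gamma>"
      unfolding transitive_set_def \<gamma>(2) using \<gamma>(1) v_ord ordinal_trans by blast
    moreover have "transitive_set \<beta>" if "\<beta> \<^bold>\<in> \<gamma>" for \<beta>
      using that v_ord unfolding \<gamma>(2) ordinal_def by blast
    ultimately show ?thesis unfolding ordinal_def by blast
  qed
  moreover have "osucc \<beta> \<^bold>\<in> \<gamma>" if "\<beta> \<^bold>\<in> \<gamma>" for \<beta>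
    using that v_osucc v_ord osucc_mem_osucc unfolding \<gamma>(2) by blast
  moreover have "\<gamma> \<noteq> nul" using \<open>\<alpha> \<^bold>\<in> \<gamma>\<close> by auto
  ultimately show ?thesis unfolding limit_ordinal_def by blast
qed

section \<open>Predecessor sets and the magmatic pair\<close>

lemma subset_refl: "is_set x \<Longrightarrow> x \<^bold>\<subseteq> x"
  unfolding subset_of_def by blast

lemma subset_trans: "x \<^bold>\<subseteq> y \<Longrightarrow> y \<^bold>\<subseteq> z \<Longrightarrow> x \<^bold>\<subseteq> z"
  unfolding subset_of_def by blast

lemma subset_antisym: "x \<^bold>\<subseteq> y \<Longrightarrow> y \<^bold>\<subseteq> x \<Longrightarrow> x = y"
  unfolding subset_of_def by (blast intro: set_ext)

lemma subsetD: "x \<^bold>\<subseteq> y \<Longrightarrow> z \<^bold>\<in> x \<Longrightarrow> z \<^bold>\<in> y"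
  unfolding subset_of_def by blast

text \<open>Although the magmas form a proper class, those included in \<open>x\<close> are bounded
  by the power set of \<open>x\<close>, and being a magma is definable; this gives the set that
  \<open>pr\<close> describes.\<close>

lemma
  assumes "is_set x"
  shows is_set_pr: "is_set (pr R x)"
    and mem_pr: "z \<^bold>\<in> pr R x \<longleftrightarrow> z \<in> magmas R \<and> z \<^bold>\<subseteq> x"
proof -
  have "\<exists>v. \<forall>z. z \<^bold>\<in> v \<longleftrightarrow> z \<^bold>\<subseteq> x \<and> z \<in> magmas R"
    by (rule subset_separation) (intro dintros)
  then have ex: "\<exists>v. \<forall>z. z \<^bold>\<in> v \<longleftrightarrow> z \<in> magmas R \<and> z \<^bold>\<subseteq> x" by (simp only: conj_commute)
  have pr: "pr R x = the_set (\<lambda>y. y \<in> magmas R \<and> y \<^bold>\<subseteq> x)"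
    using assms unfolding pr_def is_set_def by simp
  show "is_set (pr R x)" "z \<^bold>\<in> pr R x \<longleftrightarrow> z \<in> magmas R \<and> z \<^bold>\<subseteq> x"
    unfolding pr by (rule is_set_the_set[OF ex] mem_the_set[OF ex])+
qed

lemma
  assumes "a \<^bold>\<in> atoms"
  shows is_set_pr_atom: "is_set (pr R a)"
    and mem_pr_atom: "z \<^bold>\<in> pr R a \<longleftrightarrow> z \<^bold>\<in> atoms \<and> atom_le R z a"
proof -
  have ex: "\<exists>v. \<forall>z. z \<^bold>\<in> v \<longleftrightarrow> z \<^bold>\<in> atoms \<and> atom_le R z a"
    by (rule separation_definable) (intro dintros)
  have pr: "pr R a = the_set (\<lambda>b. b \<^bold>\<in> atoms \<and> atom_le R b a)"
    using assms unfolding pr_def by simp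
  show "is_set (pr R a)" "z \<^bold>\<in> pr R a \<longleftrightarrow> z \<^bold>\<in> atoms \<and> atom_le R z a"
    unfolding pr by (rule is_set_the_set[OF ex] mem_the_set[OF ex])+
qed

lemma mem_pr_self: "x \<in> magmas R \<Longrightarrow> x \<^bold>\<in> pr R x"
  using mem_pr magma_is_set(1) subset_refl by blast

text \<open>If \<open>x\<close> has level \<alpha>, then all magmas included in it have level
  \<alpha> too, and transitivity of inclusion gives downward closure.\<close>

lemma pr_magma:
  assumes "x \<in> magmas R"
  shows "pr R x \<in> magmas R"
proof -
  obtain \<alpha> where \<alpha>: "in_level R \<alpha> x" using assms unfolding magmas_iff by blast
  then have o: "ordinal \<alpha>" "\<alpha> \<noteq> nul" unfolding in_level_def by blast+
  have x: "is_set x" using assms magma_is_set(1) by blast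
  have "in_level R (osucc \<alpha>) (pr R x)"
    unfolding in_level_osucc[OF o] mem_pr[OF x]
  proof (intro conjI allI impI)
    show "is_set (pr R x)" by (rule is_set_pr[OF x])
    show "pr R x \<noteq> nul" using mem_pr_self[OF assms] by auto
    show "in_level R \<alpha> y" if "y \<in> magmas R \<and> y \<^bold>\<subseteq> x" for y using in_level_subset[OF \<alpha>] that by blast
  qed (use in_level_magmas subset_trans in blast)+
  then show ?thesis by (rule in_level_magmas)
qed

text \<open>Transitivity of the preorder gives downward closure in level one; reflexivity gives the
  element \<open>a\<close>, which also shows that the set is nonempty.\<close>

lemma pr_atom_magma:
  assumes "preorder_on_atoms R" "a \<^bold>\<in> atoms"
  shows "pr R a \<in> magmas R" and "a \<^bold>\<in> pr R a"
proof -
  show a: "a \<^bold>\<in> pr R a" using assms unfolding mem_pr_atom[OF assms(2)] preorder_on_atoms_def by blast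
  have trans: "atom_le R b c" if "atom_le R b d" "atom_le R d c" for b c d
    using assms(1) that unfolding preorder_on_atoms_def by blast
  have "is_set (atoms :: 'a)" using assms(2) by (rule is_setI)
  then have "in_level R (osucc nul) (pr R a)"
    unfolding in_level_one subset_of_def mem_pr_atom[OF assms(2)]
    using is_set_pr_atom[OF assms(2)] a trans not_mem_nul by metis
  then show "pr R a \<in> magmas R" by (rule in_level_magmas)
qed

lemma common_limit_level:
  assumes "u \<in> magmas R" "w \<in> magmas R"
  obtains \<gamma> where "limit_ordinal \<gamma>" "\<And>z. z \<in> magmas R \<Longrightarrow> z \<^bold>\<subseteq> u \<or> z \<^bold>\<subseteq> w \<Longrightarrow> in_level R \<gamma> z"
proof -
  obtain \<alpha> \<beta> where \<alpha>: "in_level R \<alpha> u" and \<beta>: "in_level R \<beta> w" using assms unfolding magmas_iff by blast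
  note o = in_level_ordinal[OF \<alpha>] in_level_ordinal[OF \<beta>]
  obtain \<gamma> where \<gamma>: "limit_ordinal \<gamma>" "\<alpha> \<^bold>\<in> \<gamma>" "\<beta> \<^bold>\<in> \<gamma>"
  proof -
    obtain \<gamma> where *: "limit_ordinal \<gamma>" "\<alpha> \<^bold>\<in> \<gamma>" using limit_ordinal_above[OF o(1)] by blast
    obtain \<delta> where **: "limit_ordinal \<delta>" "\<beta> \<^bold>\<in> \<delta>" using limit_ordinal_above[OF o(2)] by blast
    have "ordinal \<gamma>" "ordinal \<delta>" using * ** unfolding limit_ordinal_def by blast+
    then show thesis
      \<comment> \<open>Of the two limits, the one above the larger of \<alpha> and \<beta> also
        contains the smaller.\<close>
      using that * ** ordinal_linear[OF o] ordinal_trans[of \<gamma> \<alpha> \<beta>] ordinal_trans[of \<delta> \<beta> \<alpha>] by blast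
  qed
  have "in_level R \<gamma> z" if "z \<in> magmas R" "z \<^bold>\<subseteq> u \<or> z \<^bold>\<subseteq> w" for z
    unfolding in_level_limit[OF \<gamma>(1)]
    using that(2) in_level_subset[OF \<alpha> that(1)] in_level_subset[OF \<beta> that(1)] \<gamma>(2,3) by blast
  then show thesis using that \<gamma>(1) by blast
qed

lemma pr_un_pr_magma:
  assumes "u \<in> magmas R" "w \<in> magmas R"
  shows "pr R u \<^bold>\<union> pr R w \<in> magmas R"
proof -
  obtain \<gamma> where \<gamma>: "limit_ordinal \<gamma>"
    "\<And>z. z \<in> magmas R \<Longrightarrow> z \<^bold>\<subseteq> u \<or> z \<^bold>\<subseteq> w \<Longrightarrow> in_level R \<gamma> z"
    by (rule common_limit_level[OF assms]) blast
  have o: "ordinal \<gamma>" "\<gamma> \<noteq> nul" using \<gamma>(1) unfolding limit_ordinal_def by blast+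
  have s: "is_set u" "is_set w" using assms magma_is_set(1) by blast+
  have "in_level R (osucc \<gamma>) (pr R u \<^bold>\<union> pr R w)"
    unfolding in_level_osucc[OF o] mem_un mem_pr[OF s(1)] mem_pr[OF s(2)]
  proof (intro conjI allI impI)
    show "pr R u \<^bold>\<union> pr R w \<noteq> nul" using mem_pr_self[OF assms(1)] mem_un not_mem_nul by metis
    show "in_level R \<gamma> z" if "z \<in> magmas R \<and> z \<^bold>\<subseteq> u \<or> z \<in> magmas R \<and> z \<^bold>\<subseteq> w" for z
      using \<gamma>(2) that by blast
  qed (use in_level_magmas subset_trans is_set_un in blast)+
  then show ?thesis by (rule in_level_magmas)
qed

text \<open>Treats one component with the atoms named neutrally and incomparability assumed in one
  direction only, so that exchanging the atoms gives the other component.\<close>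

lemma pair_component_subset:
  assumes R: "preorder_on_atoms R" and a: "a \<^bold>\<in> atoms" and b: "b \<^bold>\<in> atoms" and nle: "\<not> atom_le R a b"
    and x: "x \<in> magmas R" and x': "x' \<in> magmas R" and y': "y' \<in> magmas R"
    and mem: "pr R (pr R x) \<^bold>\<union> pr R (pr R a) \<^bold>\<in>
      pr R (pr R (pr R x') \<^bold>\<union> pr R (pr R a)) \<^bold>\<union> pr R (pr R (pr R y') \<^bold>\<union> pr R (pr R b))"
  shows "x \<^bold>\<subseteq> x'"
proof -
  let ?U = "\<lambda>x a. pr R (pr R x) \<^bold>\<union> pr R (pr R a)"
  note pra = pr_atom_magma[OF R a] and prb = pr_atom_magma[OF R b]
  have U_iff: "z \<^bold>\<in> ?U w c \<longleftrightarrow> z \<in> magmas R \<and> (z \<^bold>\<subseteq> pr R w \<or> z \<^bold>\<subseteq> pr R c)"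
    if "w \<in> magmas R" "pr R c \<in> magmas R" for w c z
    using mem_pr[OF magma_is_set(1)[OF that(2)]] mem_pr[OF magma_is_set(1)[OF pr_magma[OF that(1)]]]
    by auto
  have mem_pr': "z \<^bold>\<in> pr R w \<longleftrightarrow> z \<in> magmas R \<and> z \<^bold>\<subseteq> w" if "w \<in> magmas R" for w z
    using mem_pr[OF magma_is_set(1)[OF that]] .
  have not_atom: "\<not> w \<^bold>\<in> atoms" if "w \<in> magmas R" for w
    using magma_is_set(1)[OF that] unfolding is_set_def .
  have "pr R a \<^bold>\<in> ?U x a"
    unfolding U_iff[OF x pra(1)] using pra(1) magma_is_set(1) subset_refl by blast
  have "\<not> ?U x a \<^bold>\<subseteq> ?U y' b"
  proof
    assume "?U x a \<^bold>\<subseteq> ?U y' b"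
    then have "pr R a \<^bold>\<in> ?U y' b" using \<open>pr R a \<^bold>\<in> ?U x a\<close> subsetD by blast
    then have "a \<^bold>\<in> pr R y' \<or> a \<^bold>\<in> pr R b"
      unfolding U_iff[OF y' prb(1)] using pra(2) subsetD by blast
    then show False using not_atom[of a] a nle unfolding mem_pr'[OF y'] mem_pr_atom[OF b] by blast
  qed
  then have "?U x a \<^bold>\<subseteq> ?U x' a"
    using mem mem_pr[OF is_set_un] by (metis mem_un)
  moreover have "pr R x \<^bold>\<in> ?U x a"
    unfolding U_iff[OF x pra(1)] using pr_magma[OF x] magma_is_set(1) subset_refl by blast
  ultimately have "pr R x \<^bold>\<in> ?U x' a" using subsetD by blast
  then have "x \<^bold>\<in> pr R x' \<or> x \<^bold>\<in> pr R a"
    unfolding U_iff[OF x' pra(1)] using mem_pr_self[OF x] subsetD by blast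
  then show ?thesis using not_atom[OF x] unfolding mem_pr'[OF x'] mem_pr_atom[OF a] by blast
qed

text \<open>Inclusions suffice: the hypotheses are symmetric between primed and unprimed magmas, so
  a second use yields the reverse inclusions.\<close>

lemma magma_pair_subset:
  assumes R: "preorder_on_atoms R" and a0: "a0 \<^bold>\<in> atoms" and a1: "a1 \<^bold>\<in> atoms"
    and nle: "\<not> atom_le R a0 a1" "\<not> atom_le R a1 a0"
    and M: "x \<in> magmas R" "y \<in> magmas R" "x' \<in> magmas R" "y' \<in> magmas R"
    and eq: "magma_pair R a0 a1 x y = magma_pair R a0 a1 x' y'"
  shows "x \<^bold>\<subseteq> x' \<and> y \<^bold>\<subseteq> y'"
proof -
  let ?U = "\<lambda>x a. pr R (pr R x) \<^bold>\<union> pr R (pr R a)"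
  have "?U w a \<^bold>\<in> pr R (?U w a)" if "w \<in> magmas R" "a \<^bold>\<in> atoms" for w a
    using pr_un_pr_magma[OF pr_magma[OF that(1)] pr_atom_magma(1)[OF R that(2)]] by (rule mem_pr_self)
  then have "?U x a0 \<^bold>\<in> magma_pair R a0 a1 x' y'" "?U y a1 \<^bold>\<in> magma_pair R a0 a1 x' y'"
    unfolding eq[symmetric] using M a0 a1 by (simp_all add: magma_pair_def)
  \<comment> \<open>The second membership is stated with the parts of the union exchanged, to match
    the component lemma with the atoms swapped.\<close>
  then have "?U x a0 \<^bold>\<in> pr R (?U x' a0) \<^bold>\<union> pr R (?U y' a1)"
    "?U y a1 \<^bold>\<in> pr R (?U y' a1) \<^bold>\<union> pr R (?U x' a0)"
    unfolding magma_pair_def mem_un by blast+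
  then show ?thesis
    using pair_component_subset[OF R a0 a1 nle(1) M(1,3,4)]
      pair_component_subset[OF R a1 a0 nle(2) M(2,4,3)] by blast
qed

theorem theorem3p4:
  fixes R a0 a1 x y x' y' :: "'v::zfa"
  assumes "preorder_on_atoms R"
    and "no_minimal_atoms R"
    and "a0 \<^bold>\<in> atoms" and "a1 \<^bold>\<in> atoms"
    and "\<not> atom_le R a0 a1" and "\<not> atom_le R a1 a0"
    and "x \<in> magmas R" and "y \<in> magmas R" and "x' \<in> magmas R" and "y' \<in> magmas R"
  shows "magma_pair R a0 a1 x y = magma_pair R a0 a1 x' y' \<longleftrightarrow> x = x' \<and> y = y'"
proof
  assume eq: "magma_pair R a0 a1 x y = magma_pair R a0 a1 x' y'"
  have "x \<^bold>\<subseteq> x' \<and> y \<^bold>\<subseteq> y'"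
    using magma_pair_subset[OF assms(1,3-6) assms(7,8,9,10) eq] .
  moreover have "x' \<^bold>\<subseteq> x \<and> y' \<^bold>\<subseteq> y"
    using magma_pair_subset[OF assms(1,3-6) assms(9,10,7,8) eq[symmetric]] .
  ultimately show "x = x' \<and> y = y'" using subset_antisym by blast
qed simp

end
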